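(* Let $N\ge 1$ be an integer. Let $f:\mathbb{R}\to\mathbb{R}$ be a continuous function such that, for some constants $a>0$ and $q>2$, $|f(u)|\le a(|u|+|u|^{q-1})$ for all $u\in\mathbb{R}$. Put $F(u)=\int_0^u f(s)\,ds$. Assume: (i) $f(u)=o(u)$ as $u\to0$; (ii) $u\mapsto\frac{f(u)}{|u|}$ is strictly increasing on $(-\infty,0)$ and strictly increasing on $(0,+\infty)$; (iii) $\frac{F(u)}{u^2}\to\infty$ as $|u|\to\infty$. Moreover, assume that $V:\mathbb{Z}^N\to\mathbb{R}$ is a bounded potential well, i.e. there are constants $V_0,V_\infty$ with $$0<V_0\le\inf_{\mathbb{Z}^N}V(x)\le\sup_{\mathbb{Z}^N}V(x)=V_\infty<\infty\quad\text{and}\quad V_\infty=\lim_{|x|\to\infty}V(x).$$ Then the equation $$-\Delta u+V(x)u=f(u)\quad (x\in\mathbb{Z}^N),\qquad u\in H^1(\mathbb{Z}^N),$$ has a ground state solution.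
   Context: $\mathbb{Z}^N$ denotes the standard lattice graph: vertices are the integer points $x=(x_1,\dots,x_N)$, and $x\sim y$ (neighbours) iff $\sum_{i=1}^N|x_i-y_i|=1$. The Laplacian is $\Delta u(x)=\sum_{y\sim x}(u(y)-u(x))$. $H^1(\mathbb{Z}^N)$ is the completion of the finitely supported functions $C_c(\mathbb{Z}^N)$ under the norm $\|u\|_{H^1}=\big(\frac12\sum_{x}\sum_{y\sim x}(u(y)-u(x))^2+\sum_x u(x)^2\big)^{1/2}$ (which, as the degree is bounded, is equivalent to the $\ell^2$ norm, so $H^1(\mathbb{Z}^N)$ is $\ell^2(\mathbb{Z}^N)$ as a set). The energy functional on $H^1(\mathbb{Z}^N)$ is $$\Phi(u)=\frac12\sum_{x\in\mathbb{Z}^N}\Big(\frac12\sum_{y\sim x}(u(y)-u(x))^2+V(x)u(x)^2\Big)-\sum_{x\in\mathbb{Z}^N}F(u(x)).$$ A ground state solution is a solution $u\in H^1(\mathbb{Z}^N)$ of the equation corresponding to the least positive critical value of $\Phi$, i.e. $\Phi'(u)=0$, $\Phi(u)>0$, and $\Phi(u)\le\Phi(v)$ for every $v\in H^1(\mathbb{Z}^N)$ with $\Phi'(v)=0$ and $\Phi(v)>0$. *)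

theory Defs
  imports "HOL-Analysis.Analysis" "HOL-Library.Landau_Symbols"
begin

section \<open>The lattice graph\<close>

definition lattice_norm :: "int ^ 'n::finite \<Rightarrow> int" where
  "lattice_norm x = (\<Sum>i\<in>UNIV. \<bar>x $ i\<bar>)"

definition nbrs :: "int ^ 'n::finite \<Rightarrow> (int ^ 'n) set" where
  "nbrs x = {y. (\<Sum>i\<in>UNIV. \<bar>x $ i - y $ i\<bar>) = 1}"

definition laplacian :: "(int ^ 'n::finite \<Rightarrow> real) \<Rightarrow> int ^ 'n \<Rightarrow> real" where
  "laplacian u x = (\<Sum>y\<in>nbrs x. u y - u x)"

lemma finite_nbrs [simp]: "finite (nbrs (x :: int ^ 'n::finite))"
proof (rule finite_subset)
  let ?P = "PiE UNIV (\<lambda>i. {x $ i - 1..x $ i + 1})"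
  show "finite (vec_lambda ` ?P)"
    by (intro finite_imageI finite_PiE) auto
  show "nbrs x \<subseteq> vec_lambda ` ?P"
  proof
    fix y assume y: "y \<in> nbrs x"
    have "\<bar>x $ i - y $ i\<bar> \<le> 1" for i
    proof -
      have "\<bar>x $ i - y $ i\<bar> \<le> (\<Sum>i\<in>UNIV. \<bar>x $ i - y $ i\<bar>)"
        by (rule member_le_sum) auto
      then show ?thesis using y by (simp add: nbrs_def)
    qed
    then have "vec_nth y \<in> ?P"
      by (auto simp: PiE_UNIV_domain abs_le_iff algebra_simps)
    then show "y \<in> vec_lambda ` ?P"
      by (metis image_eqI vec_nth_inverse)
  qed
qed

lemma nbrs_eq_translate: "nbrs x = (\<lambda>e. x + e) ` nbrs 0"
proof (intro equalityI subsetI)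
  fix y assume "y \<in> nbrs x"
  then have "y - x \<in> nbrs 0" by (simp add: nbrs_def abs_minus_commute)
  then show "y \<in> (\<lambda>e. x + e) ` nbrs 0" by (metis diff_add_cancel add.commute image_eqI)
next
  fix y assume "y \<in> (\<lambda>e. x + e) ` nbrs 0"
  then show "y \<in> nbrs x" by (auto simp: nbrs_def)
qed

lemma sum_nbrs: "(\<Sum>y\<in>nbrs x. g y) = (\<Sum>e\<in>nbrs 0. g (x + e))"
  unfolding nbrs_eq_translate[of x] by (subst sum.reindex) (auto simp: inj_on_def)

section \<open>Square-summable functions\<close>

definition sqsum :: "('a \<Rightarrow> real) \<Rightarrow> bool" where
  "sqsum u \<longleftrightarrow> (\<lambda>x. (u x)\<^sup>2) summable_on UNIV"

lemma sqsum_mult: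
  assumes "sqsum u" "sqsum v"
  shows "(\<lambda>x. u x * v x) summable_on UNIV"
proof -
  have "(\<lambda>x. (u x)\<^sup>2 + (v x)\<^sup>2) summable_on UNIV"
    using assms unfolding sqsum_def by (rule summable_on_add)
  moreover have "norm (u x * v x) \<le> (u x)\<^sup>2 + (v x)\<^sup>2" for x
  proof -
    have "0 \<le> (\<bar>u x\<bar> - \<bar>v x\<bar>)\<^sup>2" by simp
    then have "2 * (\<bar>u x\<bar> * \<bar>v x\<bar>) \<le> (u x)\<^sup>2 + (v x)\<^sup>2"
      by (simp add: power2_diff)
    moreover have "0 \<le> \<bar>u x\<bar> * \<bar>v x\<bar>" by simp
    ultimately have "\<bar>u x\<bar> * \<bar>v x\<bar> \<le> (u x)\<^sup>2 + (v x)\<^sup>2" by linarith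
    then show ?thesis by (simp add: abs_mult)
  qed
  ultimately have "(\<lambda>x. norm (u x * v x)) summable_on UNIV"
    by (rule summable_on_comparison_test) auto
  then show ?thesis by (rule abs_summable_summable)
qed

lemma sqsum_add:
  assumes "sqsum u" "sqsum v"
  shows "sqsum (\<lambda>x. u x + v x)"
proof -
  have "(\<lambda>x. (u x)\<^sup>2 + (v x)\<^sup>2 + 2 * (u x * v x)) summable_on UNIV"
    using assms sqsum_mult[OF assms] unfolding sqsum_def
    by (intro summable_on_add summable_on_cmult_right) auto
  then show ?thesis by (simp add: sqsum_def power2_sum mult.assoc)
qed

lemma sqsum_cmult: "sqsum u \<Longrightarrow> sqsum (\<lambda>x. c * u x)"
  by (simp add: sqsum_def power_mult_distrib summable_on_cmult_right)

lemma sqsum_diff: "sqsum u \<Longrightarrow> sqsum v \<Longrightarrow> sqsum (\<lambda>x. u x - v x)"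
  using sqsum_add[of u "\<lambda>x. (-1) * v x"] sqsum_cmult[of v "-1"] by simp

lemma sqsum_zero: "sqsum (\<lambda>_. 0)"
  by (simp add: sqsum_def)

lemma bij_translate: "bij (\<lambda>x. x + (e :: 'a::group_add))"
  by (rule o_bij[of "\<lambda>x. x - e"]) (auto simp: fun_eq_iff)

lemma sqsum_translate:
  assumes "sqsum u" shows "sqsum (\<lambda>x. u (x + (e :: 'a::group_add)))"
  using assms summable_on_reindex_bij_betw[OF bij_translate[of e], of "\<lambda>x. (u x)\<^sup>2"]
  by (simp add: sqsum_def)

lemma summable_on_finite_sum:
  fixes g :: "'b \<Rightarrow> 'a \<Rightarrow> real"
  assumes "finite E" and "\<And>e. e \<in> E \<Longrightarrow> g e summable_on A"
  shows "(\<lambda>x. \<Sum>e\<in>E. g e x) summable_on A"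
    and "(\<Sum>\<^sub>\<infinity>x\<in>A. \<Sum>e\<in>E. g e x) = (\<Sum>e\<in>E. \<Sum>\<^sub>\<infinity>x\<in>A. g e x)"
proof -
  have "(\<lambda>x. \<Sum>e\<in>E. g e x) summable_on A \<and>
      (\<Sum>\<^sub>\<infinity>x\<in>A. \<Sum>e\<in>E. g e x) = (\<Sum>e\<in>E. \<Sum>\<^sub>\<infinity>x\<in>A. g e x)"
    using assms by (induction E rule: finite_induct) (auto simp: infsum_add intro!: summable_on_add)
  then show "(\<lambda>x. \<Sum>e\<in>E. g e x) summable_on A"
    and "(\<Sum>\<^sub>\<infinity>x\<in>A. \<Sum>e\<in>E. g e x) = (\<Sum>e\<in>E. \<Sum>\<^sub>\<infinity>x\<in>A. g e x)" by auto
qed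

lemma grad_prod_summable:
  fixes u v :: "int ^ 'n::finite \<Rightarrow> real"
  assumes "sqsum u" "sqsum v"
  shows "(\<lambda>x. \<Sum>y\<in>nbrs x. (u y - u x) * (v y - v x)) summable_on UNIV"
proof -
  have "(\<lambda>x. (u (x + e) - u x) * (v (x + e) - v x)) summable_on UNIV" for e
    by (intro sqsum_mult sqsum_diff sqsum_translate assms)
  then have "(\<lambda>x. \<Sum>e\<in>nbrs 0. (u (x + e) - u x) * (v (x + e) - v x)) summable_on UNIV"
    by (rule summable_on_finite_sum(1)[OF finite_nbrs])
  moreover have "(\<lambda>x. \<Sum>y\<in>nbrs x. (u y - u x) * (v y - v x)) =
      (\<lambda>x. \<Sum>e\<in>nbrs 0. (u (x + e) - u x) * (v (x + e) - v x))"
    by (rule ext) (rule sum_nbrs)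
  ultimately show ?thesis by simp
qed

section \<open>The space $H^1$\<close>

text \<open>The completion of the finitely supported functions is realised as the square-summable
  functions with the $H^1$ norm. The instance \<open>h1 :: banach\<close> and the lemma \<open>h1_finsupp_dense\<close>
  below show that this is indeed that completion.\<close>

typedef 'n h1 = "{u :: int ^ 'n::finite \<Rightarrow> real. (\<lambda>x. (u x)\<^sup>2) summable_on UNIV}"
  morphisms h1_fun Abs_h1
  by (rule exI[of _ "\<lambda>_. 0"]) simp

lemma sqsum_h1 [simp]: "sqsum (h1_fun u)"
  using h1_fun[of u] by (simp add: sqsum_def)

lemma h1_fun_Abs: "sqsum u \<Longrightarrow> h1_fun (Abs_h1 u) = u"
  by (rule Abs_h1_inverse) (simp add: sqsum_def)

lemma h1_eqI: "(\<And>x. h1_fun u x = h1_fun v x) \<Longrightarrow> u = v"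
  by (metis ext h1_fun_inject)

instantiation h1 :: (finite) real_vector
begin
definition "0 = Abs_h1 (\<lambda>_. 0)"
definition "u + v = Abs_h1 (\<lambda>x. h1_fun u x + h1_fun v x)"
definition "u - v = Abs_h1 (\<lambda>x. h1_fun u x - h1_fun v x)"
definition "- u = Abs_h1 (\<lambda>x. - h1_fun u x)"
definition "c *\<^sub>R u = Abs_h1 (\<lambda>x. c * h1_fun u x)"

lemma h1_fun_simps [simp]:
  "h1_fun 0 x = 0"
  "h1_fun (u + v) x = h1_fun u x + h1_fun v x"
  "h1_fun (u - v) x = h1_fun u x - h1_fun v x"
  "h1_fun (- u) x = - h1_fun u x"
  "h1_fun (c *\<^sub>R u) x = c * h1_fun u x"
  using sqsum_cmult[of "h1_fun u" "-1"]
  by (simp_all add: zero_h1_def plus_h1_def minus_h1_def uminus_h1_def scaleR_h1_def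
      h1_fun_Abs sqsum_zero sqsum_add sqsum_diff sqsum_cmult)

instance
  by standard (auto intro!: h1_eqI simp: algebra_simps)
end

instantiation h1 :: (finite) real_inner
begin

definition
  "inner u v =
    (1/2) * (\<Sum>\<^sub>\<infinity>x. \<Sum>y\<in>nbrs x. (h1_fun u y - h1_fun u x) * (h1_fun v y - h1_fun v x))
    + (\<Sum>\<^sub>\<infinity>x. h1_fun u x * h1_fun v x)"

definition norm_h1_def:
  "norm u = sqrt ((1/2) * (\<Sum>\<^sub>\<infinity>x. \<Sum>y\<in>nbrs x. (h1_fun u y - h1_fun u x)\<^sup>2)
    + (\<Sum>\<^sub>\<infinity>x. (h1_fun u x)\<^sup>2))"

definition dist_h1_def: "dist u v = norm (u - v :: 'a h1)"
definition sgn_h1_def: "sgn u = u /\<^sub>R norm (u :: 'a h1)"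
definition uniformity_h1_def:
  "(uniformity :: ('a h1 \<times> 'a h1) filter) = (INF e\<in>{0<..}. principal {(x, y). dist x y < e})"
definition open_h1_def:
  "open (U :: 'a h1 set) \<longleftrightarrow> (\<forall>x\<in>U. eventually (\<lambda>(x', y). x' = x \<longrightarrow> y \<in> U) uniformity)"

instance
proof
  fix u v w :: "'a h1" and c :: real
  note s1 = grad_prod_summable[OF sqsum_h1 sqsum_h1]
  note s2 = sqsum_mult[OF sqsum_h1 sqsum_h1]
  show "dist u v = norm (u - v)" by (rule dist_h1_def)
  show "sgn u = u /\<^sub>R norm u" by (rule sgn_h1_def)
  show "(uniformity :: ('a h1 \<times> 'a h1) filter)
      = (INF e\<in>{0<..}. principal {(x, y). dist x y < e})" by (rule uniformity_h1_def)
  show "open U \<longleftrightarrow> (\<forall>x\<in>U. eventually (\<lambda>(x', y). x' = x \<longrightarrow> y \<in> U) uniformity)"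
    for U :: "'a h1 set" by (rule open_h1_def)
  show "inner u v = inner v u" by (simp add: inner_h1_def mult.commute)
  have "(\<Sum>\<^sub>\<infinity>x. \<Sum>y\<in>nbrs x. (h1_fun (u + v) y - h1_fun (u + v) x) * (h1_fun w y - h1_fun w x))
      = (\<Sum>\<^sub>\<infinity>x. (\<Sum>y\<in>nbrs x. (h1_fun u y - h1_fun u x) * (h1_fun w y - h1_fun w x))
          + (\<Sum>y\<in>nbrs x. (h1_fun v y - h1_fun v x) * (h1_fun w y - h1_fun w x)))"
    by (simp add: sum.distrib[symmetric] algebra_simps)
  also have "\<dots> = (\<Sum>\<^sub>\<infinity>x. \<Sum>y\<in>nbrs x. (h1_fun u y - h1_fun u x) * (h1_fun w y - h1_fun w x))
      + (\<Sum>\<^sub>\<infinity>x. \<Sum>y\<in>nbrs x. (h1_fun v y - h1_fun v x) * (h1_fun w y - h1_fun w x))"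
    by (rule infsum_add[OF s1 s1])
  finally show "inner (u + v) w = inner u w + inner v w"
    by (simp add: inner_h1_def distrib_right infsum_add[OF s2 s2] distrib_left)
  have "(\<Sum>\<^sub>\<infinity>x. \<Sum>y\<in>nbrs x. (h1_fun (c *\<^sub>R u) y - h1_fun (c *\<^sub>R u) x) * (h1_fun w y - h1_fun w x))
      = (\<Sum>\<^sub>\<infinity>x. c * (\<Sum>y\<in>nbrs x. (h1_fun u y - h1_fun u x) * (h1_fun w y - h1_fun w x)))"
    by (simp add: sum_distrib_left algebra_simps)
  also have "\<dots> = c * (\<Sum>\<^sub>\<infinity>x. \<Sum>y\<in>nbrs x. (h1_fun u y - h1_fun u x) * (h1_fun w y - h1_fun w x))"
    by (rule infsum_cmult_right[OF s1])
  finally show "inner (c *\<^sub>R u) w = c * inner u w"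
    by (simp add: inner_h1_def mult.assoc infsum_cmult_right[OF s2] distrib_left)
  have g: "0 \<le> (\<Sum>\<^sub>\<infinity>x. \<Sum>y\<in>nbrs x. (h1_fun u y - h1_fun u x) * (h1_fun u y - h1_fun u x))"
    by (intro infsum_nonneg sum_nonneg) auto
  have h: "0 \<le> (\<Sum>\<^sub>\<infinity>x. h1_fun u x * h1_fun u x)"
    by (intro infsum_nonneg) auto
  show "0 \<le> inner u u" using g h by (simp add: inner_h1_def)
  show "inner u u = 0 \<longleftrightarrow> u = 0"
  proof
    assume "inner u u = 0"
    then have 0: "(\<Sum>\<^sub>\<infinity>x. h1_fun u x * h1_fun u x) \<le> 0"
      using g h unfolding inner_h1_def by linarith
    have "h1_fun u x * h1_fun u x = 0" for x
      by (rule nonneg_infsum_le_0D[OF 0 s2]) auto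
    then show "u = 0" by (intro h1_eqI) simp
  qed (simp add: inner_h1_def)
  show "norm u = sqrt (inner u u)"
    by (simp add: inner_h1_def norm_h1_def power2_eq_square)
qed
end

lemma h1_l2_le_norm: "(\<Sum>\<^sub>\<infinity>x. (h1_fun u x)\<^sup>2) \<le> (norm u)\<^sup>2"
proof -
  have "0 \<le> (\<Sum>\<^sub>\<infinity>x. \<Sum>y\<in>nbrs x. (h1_fun u y - h1_fun u x)\<^sup>2)"
    "0 \<le> (\<Sum>\<^sub>\<infinity>x. (h1_fun u x)\<^sup>2)"
    by (intro infsum_nonneg sum_nonneg; simp)+
  then show ?thesis by (simp add: norm_h1_def)
qed

lemma h1_norm_le_l2:
  fixes u :: "'n::finite h1"
  shows "(norm u)\<^sup>2 \<le> (1 + 2 * real (card (nbrs (0 :: int ^ 'n)))) * (\<Sum>\<^sub>\<infinity>x. (h1_fun u x)\<^sup>2)"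
proof -
  let ?u = "h1_fun u" and ?E = "nbrs (0 :: int ^ 'n)" and ?S = "\<Sum>\<^sub>\<infinity>x. (h1_fun u x)\<^sup>2"
  have s: "(\<lambda>x. (?u x)\<^sup>2) summable_on UNIV"
    using sqsum_h1[of u] by (simp add: sqsum_def)
  have st: "(\<lambda>x. (?u (x + e))\<^sup>2) summable_on UNIV" for e
    using sqsum_translate[OF sqsum_h1[of u]] by (simp add: sqsum_def)
  have sd: "(\<lambda>x. (?u (x + e) - ?u x)\<^sup>2) summable_on UNIV" for e
    using sqsum_diff[OF sqsum_translate[OF sqsum_h1[of u]] sqsum_h1[of u]] by (simp add: sqsum_def)
  have e: "(\<Sum>\<^sub>\<infinity>x. (?u (x + e) - ?u x)\<^sup>2) \<le> 4 * ?S" for e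
  proof -
    have "(\<Sum>\<^sub>\<infinity>x. (?u (x + e) - ?u x)\<^sup>2) \<le> (\<Sum>\<^sub>\<infinity>x. 2 * (?u (x + e))\<^sup>2 + 2 * (?u x)\<^sup>2)"
    proof (rule infsum_mono[OF sd])
      show "(\<lambda>x. 2 * (?u (x + e))\<^sup>2 + 2 * (?u x)\<^sup>2) summable_on UNIV"
        by (intro summable_on_add summable_on_cmult_right s st)
      fix x
      have "0 \<le> (?u (x + e) + ?u x)\<^sup>2" by simp
      then show "(?u (x + e) - ?u x)\<^sup>2 \<le> 2 * (?u (x + e))\<^sup>2 + 2 * (?u x)\<^sup>2"
        by (simp add: power2_sum power2_diff)
    qed
    also have "\<dots> = 2 * (\<Sum>\<^sub>\<infinity>x. (?u (x + e))\<^sup>2) + 2 * ?S"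
      by (subst infsum_add) (auto intro!: summable_on_cmult_right s st
          simp: infsum_cmult_right s st)
    also have "(\<Sum>\<^sub>\<infinity>x. (?u (x + e))\<^sup>2) = ?S"
      using infsum_reindex_bij_betw[OF bij_translate[of e], of "\<lambda>x. (?u x)\<^sup>2"] by simp
    finally show ?thesis by simp
  qed
  have "(\<lambda>x. \<Sum>y\<in>nbrs x. (?u y - ?u x)\<^sup>2) = (\<lambda>x. \<Sum>e\<in>?E. (?u (x + e) - ?u x)\<^sup>2)"
    by (rule ext) (rule sum_nbrs)
  then have "(\<Sum>\<^sub>\<infinity>x. \<Sum>y\<in>nbrs x. (?u y - ?u x)\<^sup>2) = (\<Sum>e\<in>?E. \<Sum>\<^sub>\<infinity>x. (?u (x + e) - ?u x)\<^sup>2)"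
    by (simp add: summable_on_finite_sum(2) sd)
  also have "\<dots> \<le> (\<Sum>e\<in>?E. 4 * ?S)" by (rule sum_mono) (rule e)
  finally have "(\<Sum>\<^sub>\<infinity>x. \<Sum>y\<in>nbrs x. (?u y - ?u x)\<^sup>2) \<le> real (card ?E) * (4 * ?S)" by simp
  moreover have "(norm u)\<^sup>2 = (1/2) * (\<Sum>\<^sub>\<infinity>x. \<Sum>y\<in>nbrs x. (?u y - ?u x)\<^sup>2) + ?S"
    unfolding norm_h1_def
    by (intro real_sqrt_pow2 add_nonneg_nonneg mult_nonneg_nonneg infsum_nonneg sum_nonneg) auto
  ultimately show ?thesis by (simp add: algebra_simps)
qed

lemma h1_sum_le_norm:
  assumes "finite A" shows "(\<Sum>x\<in>A. (h1_fun u x)\<^sup>2) \<le> (norm u)\<^sup>2"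
proof -
  have "(\<Sum>x\<in>A. (h1_fun u x)\<^sup>2) \<le> (\<Sum>\<^sub>\<infinity>x. (h1_fun u x)\<^sup>2)"
    using sqsum_h1[of u] assms by (intro finite_sum_le_infsum) (auto simp: sqsum_def)
  then show ?thesis using h1_l2_le_norm[of u] by linarith
qed

lemma h1_fun_le_norm: "\<bar>h1_fun u x\<bar> \<le> norm u"
  using h1_sum_le_norm[of "{x}" u] by (simp add: abs_le_square_iff[symmetric])

instance h1 :: (finite) banach
proof
  fix X :: "nat \<Rightarrow> 'a h1"
  assume X: "Cauchy X"
  let ?C = "1 + 2 * real (card (nbrs (0 :: int ^ 'a)))"
  have "Cauchy (\<lambda>n. h1_fun (X n) x)" for x
  proof (rule metric_CauchyI)
    fix e :: real assume "e > 0"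
    then obtain M where M: "\<And>m n. m \<ge> M \<Longrightarrow> n \<ge> M \<Longrightarrow> dist (X m) (X n) < e"
      using X unfolding Cauchy_def by metis
    have "dist (h1_fun (X m) x) (h1_fun (X n) x) \<le> dist (X m) (X n)" for m n
      using h1_fun_le_norm[of "X m - X n" x] by (simp add: dist_norm)
    then show "\<exists>M. \<forall>m\<ge>M. \<forall>n\<ge>M. dist (h1_fun (X m) x) (h1_fun (X n) x) < e"
      using M by (meson le_less_trans)
  qed
  then obtain u where u: "\<And>x. (\<lambda>n. h1_fun (X n) x) \<longlonglongrightarrow> u x"
    unfolding Cauchy_convergent_iff convergent_def by metis
  have fin: "(\<Sum>x\<in>A. (h1_fun (X m) x - u x)\<^sup>2) \<le> e\<^sup>2"
    if "finite A" and e: "\<And>n. n \<ge> m \<Longrightarrow> dist (X m) (X n) < e" for A m e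
  proof (rule LIMSEQ_le_const2)
    show "(\<lambda>n. \<Sum>x\<in>A. (h1_fun (X m) x - h1_fun (X n) x)\<^sup>2)
        \<longlonglongrightarrow> (\<Sum>x\<in>A. (h1_fun (X m) x - u x)\<^sup>2)"
      by (intro tendsto_intros u)
    have "(\<Sum>x\<in>A. (h1_fun (X m) x - h1_fun (X n) x)\<^sup>2) \<le> e\<^sup>2" if "n \<ge> m" for n
    proof -
      have "(\<Sum>x\<in>A. (h1_fun (X m) x - h1_fun (X n) x)\<^sup>2) \<le> (norm (X m - X n))\<^sup>2"
        using h1_sum_le_norm[OF \<open>finite A\<close>, of "X m - X n"] by simp
      also have "\<dots> \<le> e\<^sup>2"
        using e[OF that] by (intro power_mono) (auto simp: dist_norm)
      finally show ?thesis .
    qed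
    then show "\<exists>N. \<forall>n\<ge>N. (\<Sum>x\<in>A. (h1_fun (X m) x - h1_fun (X n) x)\<^sup>2) \<le> e\<^sup>2" by blast
  qed
  have ss: "sqsum (\<lambda>x. h1_fun (X m) x - u x)"
    if e: "\<And>n. n \<ge> m \<Longrightarrow> dist (X m) (X n) < e" for m e
    unfolding sqsum_def
    by (rule nonneg_bdd_above_summable_on) (auto intro!: bdd_aboveI[of _ "e\<^sup>2"] fin e)
  obtain M where M: "\<And>m n. m \<ge> M \<Longrightarrow> n \<ge> M \<Longrightarrow> dist (X m) (X n) < 1"
    using X unfolding Cauchy_def by (metis zero_less_one)
  have squ: "sqsum u"
    using sqsum_diff[OF sqsum_h1[of "X M"] ss[of M 1]] M by simp
  let ?L = "Abs_h1 u"
  have Lu: "h1_fun ?L = u" by (rule h1_fun_Abs[OF squ])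
  have "X \<longlonglongrightarrow> ?L"
  proof (rule metric_LIMSEQ_I)
    fix r :: real assume r: "r > 0"
    have C: "?C > 0" by (simp add: add_pos_nonneg)
    define e where "e = r / (2 * sqrt ?C)"
    have e: "e > 0" using r C by (simp add: e_def)
    then obtain N where N: "\<And>m n. m \<ge> N \<Longrightarrow> n \<ge> N \<Longrightarrow> dist (X m) (X n) < e"
      using X unfolding Cauchy_def by metis
    have "dist (X m) ?L < r" if "m \<ge> N" for m
    proof -
      have em: "\<And>n. n \<ge> m \<Longrightarrow> dist (X m) (X n) < e" using N that by (meson order_trans)
      have "(\<Sum>\<^sub>\<infinity>x. (h1_fun (X m - ?L) x)\<^sup>2) \<le> e\<^sup>2"
        using ss[OF em] fin[OF _ em] by (intro infsum_le_finite_sums) (auto simp: Lu sqsum_def)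
      then have "(norm (X m - ?L))\<^sup>2 \<le> ?C * e\<^sup>2"
        using h1_norm_le_l2[of "X m - ?L"] C by (meson mult_left_mono order_trans less_imp_le)
      also have "\<dots> = (r / 2)\<^sup>2"
      proof -
        have "K * (r / (2 * sqrt K))\<^sup>2 = (r / 2)\<^sup>2" if "K > 0" for K :: real
          using that by (simp add: power_divide power_mult_distrib)
        from this[OF C] show ?thesis by (simp only: e_def)
      qed
      finally have "norm (X m - ?L) \<le> r / 2"
        using r by (meson power2_le_imp_le less_imp_le half_gt_zero)
      then show ?thesis using r by (simp add: dist_norm)
    qed
    then show "\<exists>N. \<forall>m\<ge>N. dist (X m) ?L < r" by blast
  qed
  then show "convergent X" by (auto simp: convergent_def)
qed

lemma h1_finsupp_dense:
  "closure {u :: 'n::finite h1. finite {x. h1_fun u x \<noteq> 0}} = UNIV"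
proof (intro equalityI subset_UNIV subsetI)
  fix u :: "'n h1"
  let ?C = "1 + 2 * real (card (nbrs (0 :: int ^ 'n)))"
  have C: "?C > 0" by (simp add: add_pos_nonneg)
  have s: "(\<lambda>x. (h1_fun u x)\<^sup>2) summable_on UNIV"
    using sqsum_h1[of u] by (simp add: sqsum_def)
  show "u \<in> closure {u :: 'n h1. finite {x. h1_fun u x \<noteq> 0}}"
    unfolding closure_approachable
  proof (intro allI impI)
    fix r :: real assume r: "r > 0"
    define e where "e = (r / 2)\<^sup>2 / ?C"
    have e: "e > 0" using r C by (simp add: e_def)
    obtain A where A: "finite A" "(\<Sum>\<^sub>\<infinity>x. (h1_fun u x)\<^sup>2) - (\<Sum>x\<in>A. (h1_fun u x)\<^sup>2) \<le> e"
      using infsum_finite_approximation[OF s e] by (auto simp: dist_real_def)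
    have sqA: "sqsum (\<lambda>x. if x \<in> A then h1_fun u x else 0)"
    proof -
      have "(\<lambda>x. (h1_fun u x)\<^sup>2) summable_on A" using A(1) by simp
      then show ?thesis unfolding sqsum_def
        by (rule summable_on_cong_neutral[THEN iffD1, rotated -1]) auto
    qed
    let ?v = "Abs_h1 (\<lambda>x. if x \<in> A then h1_fun u x else 0)"
    have v: "h1_fun ?v = (\<lambda>x. if x \<in> A then h1_fun u x else 0)" by (rule h1_fun_Abs[OF sqA])
    have "(\<Sum>\<^sub>\<infinity>x. (h1_fun (?v - u) x)\<^sup>2) = (\<Sum>\<^sub>\<infinity>x\<in>UNIV - A. (h1_fun u x)\<^sup>2)"
      by (rule infsum_cong_neutral) (auto simp: v)
    also have "\<dots> = (\<Sum>\<^sub>\<infinity>x. (h1_fun u x)\<^sup>2) - (\<Sum>x\<in>A. (h1_fun u x)\<^sup>2)"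
      using A(1) s by (subst infsum_Diff) auto
    also have "\<dots> \<le> e" by (rule A(2))
    finally have "(norm (?v - u))\<^sup>2 \<le> ?C * e"
      using h1_norm_le_l2[of "?v - u"] C by (meson mult_left_mono order_trans less_imp_le)
    also have "\<dots> = (r / 2)\<^sup>2" using C by (simp add: e_def)
    finally have "norm (?v - u) \<le> r / 2"
      using r by (meson power2_le_imp_le less_imp_le half_gt_zero)
    then have "dist ?v u < r" using r by (simp add: dist_norm)
    moreover have "finite {x. h1_fun ?v x \<noteq> 0}"
      by (rule finite_subset[OF _ A(1)]) (auto simp: v)
    ultimately show "\<exists>y\<in>{u :: 'n h1. finite {x. h1_fun u x \<noteq> 0}}. dist y u < r" by blast
  qed
qed

section \<open>The equation, its energy and ground states\<close>

definition antideriv :: "(real \<Rightarrow> real) \<Rightarrow> real \<Rightarrow> real" where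
  "antideriv f u = (LBINT s=ereal 0..ereal u. f s)"

text \<open>An \<open>infsum\<close> is 0 when it does not converge. For bounded \<open>V\<close> and
  \<open>\<bar>f u\<bar> \<le> a (\<bar>u\<bar> + \<bar>u\<bar> powr (q - 1))\<close> with \<open>q > 2\<close>, both sums below converge for every \<open>u\<close>,
  since a square-summable function is also summable to every power above 2.\<close>

definition energy ::
  "(int ^ 'n \<Rightarrow> real) \<Rightarrow> (real \<Rightarrow> real) \<Rightarrow> 'n::finite h1 \<Rightarrow> real" where
  "energy V f u =
    (1/2) * (\<Sum>\<^sub>\<infinity>x. (1/2) * (\<Sum>y\<in>nbrs x. (h1_fun u y - h1_fun u x)\<^sup>2) + V x * (h1_fun u x)\<^sup>2)
    - (\<Sum>\<^sub>\<infinity>x. antideriv f (h1_fun u x))"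

definition solves_equation ::
  "(int ^ 'n \<Rightarrow> real) \<Rightarrow> (real \<Rightarrow> real) \<Rightarrow> 'n::finite h1 \<Rightarrow> bool" where
  "solves_equation V f u \<longleftrightarrow>
    (\<forall>x. - laplacian (h1_fun u) x + V x * h1_fun u x = f (h1_fun u x))"

definition critical_point :: "('a::real_normed_vector \<Rightarrow> real) \<Rightarrow> 'a \<Rightarrow> bool" where
  "critical_point \<Phi> u \<longleftrightarrow> (\<Phi> has_derivative (\<lambda>_. 0)) (at u)"

definition ground_state_solution ::
  "(int ^ 'n \<Rightarrow> real) \<Rightarrow> (real \<Rightarrow> real) \<Rightarrow> 'n::finite h1 \<Rightarrow> bool" where
  "ground_state_solution V f u \<longleftrightarrow>
    solves_equation V f u \<and> critical_point (energy V f) u \<and> energy V f u > 0 \<and>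
    (\<forall>v. critical_point (energy V f) v \<and> energy V f v > 0 \<longrightarrow> energy V f u \<le> energy V f v)"

text \<open>Boundedness of the range is what makes the real-valued infimum and supremum meaningful.\<close>

definition bounded_potential_well :: "(int ^ 'n::finite \<Rightarrow> real) \<Rightarrow> bool" where
  "bounded_potential_well V \<longleftrightarrow> bounded (range V) \<and>
    (\<exists>V\<^sub>0 Vinf. 0 < V\<^sub>0 \<and> V\<^sub>0 \<le> (INF x. V x) \<and> (SUP x. V x) = Vinf \<and>
      (V \<longlongrightarrow> Vinf) (filtercomap lattice_norm at_top))"

end

theory Submission
  imports Defs "HOL-Complex_Analysis.Great_Picard"
begin

text \<open>
  Write \<open>\<Phi>\<close> for the energy. The substitution \<open>\<tau> = t\<^sup>2\<close> turns the monotonicity of \<open>f u / \<bar>u\<bar>\<close> into strict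
  concavity of \<open>\<Phi>\<close> along each ray \<open>\<surd>\<tau> u\<close>. On every ray \<open>\<Phi>\<close> is positive near the origin, because
  \<open>f u = o(u)\<close>, and negative far out, because \<open>F\<close> is superquadratic; so each ray carries exactly one
  maximum, here called a peak. A critical point of positive energy is the peak of its ray
  (\<open>critical_positive_imp_peak\<close>), and a peak of least energy is a critical point
  (\<open>minimal_peak_critical\<close>). A ground state is therefore the same as a peak of least energy, and it
  remains to show that the infimum \<open>c\<close> of \<open>\<Phi>\<close> over the peaks is attained.

  Peaks of bounded energy are bounded in \<open>H\<^sup>1\<close> (\<open>peaks_bounded\<close>) and cannot become uniformly small
  (\<open>peak_nonvanishing\<close>). A minimising sequence of peaks can thus be translated so that a subsequence
  has a nonzero pointwise limit \<open>w\<close>, while the translated potentials converge to a translate of \<open>V\<close>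
  or to the constant \<open>V\<^sub>\<infinity>\<close>. The energy splits asymptotically into the energy of \<open>w\<close> and that of the
  remainder, at every bounded scale along the rays (\<open>energy_splitting\<close>). Comparing the scales at which
  \<open>w\<close> and the remainder peak shows that the peak on the ray of \<open>w\<close> has energy at most \<open>c\<close> for the
  limit potential (\<open>minimising_limit\<close>); no Palais--Smale sequence is used. Since \<open>V \<le> V\<^sub>\<infinity>\<close>, passing
  from the limit potential back to \<open>V\<close> does not raise the energy (\<open>minimal_peak_exists\<close>).

  The nonlinearity is only continuous, so the set of peaks need not be a differentiable manifold. What
  replaces Lagrange multipliers is that \<open>\<Phi>\<close> is strictly differentiable
  (\<open>energy_strict_derivative\<close>).
\<close>

section \<open>The nonlinearity\<close>

locale superquadratic_nonlinearity =
  fixes f :: "real \<Rightarrow> real" and a q :: real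
  assumes cont_f: "continuous_on UNIV f"
    and a_pos: "a > 0" and q_gt_2: "q > 2"
    and growth: "\<And>u. \<bar>f u\<bar> \<le> a * (\<bar>u\<bar> + \<bar>u\<bar> powr (q - 1))"
    and f_small_o: "f \<in> o[at 0](\<lambda>u. u)"
    and mono_neg: "strict_mono_on {..<0} (\<lambda>u. f u / \<bar>u\<bar>)"
    and mono_pos: "strict_mono_on {0<..} (\<lambda>u. f u / \<bar>u\<bar>)"
    and superquadratic: "filterlim (\<lambda>u. antideriv f u / u\<^sup>2) at_top at_infinity"
begin

abbreviation "F \<equiv> antideriv f"

lemma f_0 [simp]: "f 0 = 0"
  using growth[of 0] by simp

lemma F_0 [simp]: "F 0 = 0"
  by (simp add: antideriv_def zero_ereal_def[symmetric])

lemma F_deriv: "(F has_real_derivative f x) (at x)"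
proof -
  define A B where "A = min 0 x - 1" and "B = max 0 x + 1"
  have "((\<lambda>u. LBINT y=ereal 0..ereal u. f y) has_vector_derivative f x) (at x within {A..B})"
    by (rule interval_integral_FTC2)
       (auto simp: A_def B_def intro: continuous_on_subset[OF cont_f])
  then have "(F has_vector_derivative f x) (at x within {A..B})"
    by (simp add: antideriv_def[abs_def])
  moreover have "at x within {A..B} = at x"
    by (rule at_within_interior) (auto simp: A_def B_def)
  ultimately show ?thesis
    by (simp add: has_real_derivative_iff_has_vector_derivative)
qed

lemma F_mean_value: "\<exists>\<xi>. \<bar>\<xi> - c\<bar> \<le> \<bar>b - c\<bar> \<and> \<bar>\<xi> - b\<bar> \<le> \<bar>b - c\<bar> \<and> F b - F c = f \<xi> * (b - c)"
proof (cases b c rule: linorder_cases)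
  case less
  then obtain z where "b < z" "z < c" "F c - F b = (c - b) * f z"
    using MVT2[of b c F f] F_deriv by blast
  then show ?thesis by (intro exI[of _ z]) (auto simp: algebra_simps)
next
  case greater
  then obtain z where "c < z" "z < b" "F b - F c = (b - c) * f z"
    using MVT2[of c b F f] F_deriv by blast
  then show ?thesis by (intro exI[of _ z]) (auto simp: algebra_simps)
qed simp

text \<open>A slope \<open>C\<close> with \<open>\<bar>f u\<bar> \<le> C * \<bar>u\<bar>\<close> for \<open>\<bar>u\<bar> \<le> M\<close>. Square-summable functions are bounded, so the
  growth exponent \<open>q\<close> enters the analysis only through this constant.\<close>

definition lin_bound :: "real \<Rightarrow> real" where
  "lin_bound M = a * (1 + M powr (q - 2))"

lemma lin_bound_nonneg: "0 \<le> lin_bound M"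
  using a_pos by (simp add: lin_bound_def)

lemma f_lin_bound:
  assumes "\<bar>u\<bar> \<le> M" shows "\<bar>f u\<bar> \<le> lin_bound M * \<bar>u\<bar>"
proof (cases "u = 0")
  case False
  have "\<bar>u\<bar> powr (q - 1) = \<bar>u\<bar> powr (q - 2) * \<bar>u\<bar>"
    using False powr_add[of "\<bar>u\<bar>" "q - 2" 1] by simp
  also have "\<dots> \<le> M powr (q - 2) * \<bar>u\<bar>"
    using assms q_gt_2 by (intro mult_right_mono powr_mono2) auto
  finally have "a * (\<bar>u\<bar> + \<bar>u\<bar> powr (q - 1)) \<le> a * (\<bar>u\<bar> + M powr (q - 2) * \<bar>u\<bar>)"
    using a_pos by simp
  then show ?thesis
    using growth[of u] by (simp add: lin_bound_def algebra_simps)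
qed simp

lemma F_diff_bound:
  assumes "\<bar>b\<bar> \<le> M" "\<bar>c\<bar> \<le> M"
  shows "\<bar>F b - F c\<bar> \<le> lin_bound (3 * M) * (\<bar>b\<bar> + \<bar>c\<bar>) * 2 * \<bar>b - c\<bar>"
proof -
  obtain z where z: "\<bar>z - c\<bar> \<le> \<bar>b - c\<bar>" "F b - F c = f z * (b - c)"
    using F_mean_value by blast
  have "\<bar>z\<bar> \<le> \<bar>b - c\<bar> + \<bar>c\<bar>" using z(1) by linarith
  also have "\<dots> \<le> (\<bar>b\<bar> + \<bar>c\<bar>) * 2" using abs_triangle_ineq4[of b c] by simp
  finally have "\<bar>z\<bar> \<le> (\<bar>b\<bar> + \<bar>c\<bar>) * 2" .
  moreover have "\<bar>z\<bar> \<le> 3 * M" using z(1) assms by linarith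
  ultimately have "\<bar>f z\<bar> \<le> lin_bound (3 * M) * ((\<bar>b\<bar> + \<bar>c\<bar>) * 2)"
    using f_lin_bound[of z "3 * M"] lin_bound_nonneg by (meson mult_left_mono order_trans)
  then have "\<bar>f z\<bar> * \<bar>b - c\<bar> \<le> lin_bound (3 * M) * ((\<bar>b\<bar> + \<bar>c\<bar>) * 2) * \<bar>b - c\<bar>"
    by (rule mult_right_mono) simp
  then show ?thesis by (simp add: z(2) abs_mult mult.assoc)
qed

lemma F_quadratic_bound:
  assumes "\<bar>u\<bar> \<le> M" shows "\<bar>F u\<bar> \<le> 2 * lin_bound (3 * M) * u\<^sup>2"
  proof -
  have "0 \<le> M" using assms by linarith
  then have "\<bar>F u\<bar> \<le> 2 * lin_bound (3 * M) * (\<bar>u\<bar> * \<bar>u\<bar>)"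
    using F_diff_bound[of u M 0] assms by (simp add: ac_simps)
  then show ?thesis by (simp only: power2_eq_square abs_mult_self_eq)
qed

text \<open>The defect of additivity of \<open>F\<close> is bilinear in size: replacing the smaller argument by 0 costs the
  smaller one times the larger one. This is what makes the energy split for functions whose product
  is small in \<open>\<ell>\<^sup>1\<close>.\<close>

lemma F_almost_additive:
  assumes "\<bar>b\<bar> \<le> M" "\<bar>c\<bar> \<le> M"
  shows "\<bar>F (b + c) - F b - F c\<bar> \<le> 8 * lin_bound (6 * M) * (\<bar>b\<bar> * \<bar>c\<bar>)"
proof -
  have *: "\<bar>F (b + c) - F b - F c\<bar> \<le> 8 * lin_bound (6 * M) * (\<bar>b\<bar> * \<bar>c\<bar>)"
    if "\<bar>b\<bar> \<le> M" "\<bar>c\<bar> \<le> M" "\<bar>c\<bar> \<le> \<bar>b\<bar>" for b c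
  proof -
    let ?L = "lin_bound (6 * M)"
    have L: "0 \<le> ?L" by (rule lin_bound_nonneg)
    have m: "\<bar>F (b + c) - F b\<bar> \<le> ?L * (\<bar>b + c\<bar> + \<bar>b\<bar>) * 2 * \<bar>c\<bar>"
      using F_diff_bound[of "b + c" "2 * M" b] that by simp
    have "?L * (\<bar>b + c\<bar> + \<bar>b\<bar>) * 2 * \<bar>c\<bar> = ?L * 2 * ((\<bar>b + c\<bar> + \<bar>b\<bar>) * \<bar>c\<bar>)" by simp
    also have "\<dots> \<le> ?L * 2 * ((3 * \<bar>b\<bar>) * \<bar>c\<bar>)"
      using that L by (intro mult_left_mono mult_right_mono) auto
    finally have m': "\<bar>F (b + c) - F b\<bar> \<le> 6 * ?L * (\<bar>b\<bar> * \<bar>c\<bar>)" using m by (simp only: mult.assoc)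
    have "\<bar>F c\<bar> \<le> 2 * ?L * (\<bar>c\<bar> * \<bar>c\<bar>)"
      using F_quadratic_bound[of c "2 * M"] that by (simp add: power2_eq_square)
    also have "\<dots> \<le> 2 * ?L * (\<bar>b\<bar> * \<bar>c\<bar>)"
      using that L by (intro mult_left_mono mult_right_mono) auto
    finally show ?thesis using m' by (simp add: algebra_simps)
  qed
  show ?thesis
  proof (cases "\<bar>c\<bar> \<le> \<bar>b\<bar>")
    case False
    then show ?thesis using *[of c b] assms by (simp add: algebra_simps)
  qed (use * assms in auto)
qed

lemma f_small:
  assumes "\<epsilon> > 0"
  obtains \<eta> where "\<eta> > 0" "\<And>u. \<bar>u\<bar> \<le> \<eta> \<Longrightarrow> \<bar>f u\<bar> \<le> \<epsilon> * \<bar>u\<bar>" "\<And>u. \<bar>u\<bar> \<le> \<eta> \<Longrightarrow> \<bar>F u\<bar> \<le> \<epsilon> * u\<^sup>2"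
proof -
  have "eventually (\<lambda>u. norm (f u) \<le> \<epsilon> * norm u) (at 0)"
    using landau_o.smallD[OF f_small_o assms] .
  then obtain d where d: "d > 0" "\<And>u. u \<noteq> 0 \<Longrightarrow> \<bar>u\<bar> < d \<Longrightarrow> \<bar>f u\<bar> \<le> \<epsilon> * \<bar>u\<bar>"
    unfolding eventually_at by (auto simp: dist_real_def)
  have 1: "\<bar>f u\<bar> \<le> \<epsilon> * \<bar>u\<bar>" if "\<bar>u\<bar> \<le> d / 2" for u
    using d that by (cases "u = 0") auto
  have 2: "\<bar>F u\<bar> \<le> \<epsilon> * u\<^sup>2" if u: "\<bar>u\<bar> \<le> d / 2" for u
  proof -
    obtain z where z: "\<bar>z - 0\<bar> \<le> \<bar>u - 0\<bar>" "F u - F 0 = f z * (u - 0)"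
      using F_mean_value by blast
    have "\<bar>f z\<bar> \<le> \<epsilon> * \<bar>z\<bar>" using 1 z u by simp
    also have "\<dots> \<le> \<epsilon> * \<bar>u\<bar>" using z assms by simp
    finally have "\<bar>f z\<bar> * \<bar>u\<bar> \<le> \<epsilon> * \<bar>u\<bar> * \<bar>u\<bar>" by (rule mult_right_mono) simp
    then show ?thesis using z(2) by (simp add: abs_mult power2_eq_square mult.assoc)
  qed
  show ?thesis using that[of "d / 2"] d(1) 1 2 by simp
qed

text \<open>Monotonicity of \<open>f u / \<bar>u\<bar>\<close> on the two half-lines, in a form that does not depend on the sign of
  \<open>b\<close>: the quotient \<open>f (t * b) * b / t\<close> increases strictly in \<open>t\<close>.\<close>

lemma f_ray_slope:
  assumes "b \<noteq> 0" "0 < s" "s < t"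
  shows "s * f (t * b) * b > t * f (s * b) * b"
proof (cases "b > 0")
  case True
  have "f (s * b) / \<bar>s * b\<bar> < f (t * b) / \<bar>t * b\<bar>"
    using True assms by (intro strict_mono_onD[OF mono_pos]) auto
  then have "f (s * b) * t * b < f (t * b) * s * b"
    using True assms by (simp add: field_simps)
  then show ?thesis using True by (simp add: ac_simps)
next
  case False
  then have b: "b < 0" using assms by simp
  have "f (t * b) / \<bar>t * b\<bar> < f (s * b) / \<bar>s * b\<bar>"
    using b assms by (intro strict_mono_onD[OF mono_neg]) (auto simp: mult_pos_neg)
  then have "f (t * b) / (t * - b) < f (s * b) / (s * - b)"
    using b assms by (simp add: abs_mult)
  moreover have "t * - b > 0" "s * - b > 0" using b assms by (simp_all add: mult_pos_neg)
  moreover have "x * w < y * v" if "x / v < y / w" "v > 0" "w > 0" for x y v w :: real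
    using that by (simp add: field_simps)
  ultimately have "f (t * b) * (s * - b) < f (s * b) * (t * - b)" by blast
  then show ?thesis by (simp add: algebra_simps)
qed

text \<open>In the variable \<open>\<tau> = t\<^sup>2\<close> the function \<open>F (\<surd>\<tau> * b)\<close> is strictly convex, and this is its tangent
  inequality at \<open>\<tau> = 1\<close>. It is proved by the sign of the derivative in \<open>t\<close> of the difference,
  which changes at \<open>t = 1\<close> by the strict monotonicity of \<open>f u / \<bar>u\<bar>\<close>.\<close>

lemma F_ray_strict:
  assumes b: "b \<noteq> 0" and t: "0 \<le> t" "t \<noteq> 1"
  shows "F (t * b) > F b + (t\<^sup>2 - 1) / 2 * (f b * b)"
proof -
  define k where "k = (\<lambda>t. F (t * b) - t\<^sup>2 / 2 * (f b * b))"
  have k': "DERIV k t :> f (t * b) * b - t * (f b * b)" for t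
    unfolding k_def by (auto intro!: derivative_eq_intros DERIV_chain2[OF F_deriv] simp: field_simps)
  have con: "continuous_on S k" for S
    by (meson DERIV_continuous_on has_field_derivative_at_within k')
  have "k 1 < k t"
  proof (cases "t < 1")
    case True
    show ?thesis
    proof (rule DERIV_neg_imp_decreasing_open[OF True _ con])
      fix x assume "t < x" "x < 1"
      then show "\<exists>y. DERIV k x :> y \<and> y < 0"
        using f_ray_slope[of b x 1] b t k'[of x] by (auto simp: algebra_simps)
    qed
  next
    case False
    show ?thesis
    proof (rule DERIV_pos_imp_increasing_open[OF _ _ con])
      show "1 < t" using False t by simp
      fix x assume "1 < x" "x < t"
      then show "\<exists>y. DERIV k x :> y \<and> y > 0"
        using f_ray_slope[of b 1 x] b t k'[of x] by (auto simp: algebra_simps)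
    qed
  qed
  then show ?thesis by (simp add: k_def diff_divide_distrib algebra_simps)
qed

lemma F_ray_le: "0 \<le> t \<Longrightarrow> F (t * b) \<ge> F b + (t\<^sup>2 - 1) / 2 * (f b * b)"
  using F_ray_strict[of b t] by (cases "b = 0 \<or> t = 1") auto

text \<open>The tangent inequality at \<open>t = 0\<close> gives \<open>f b * b \<ge> 2 * F b\<close>; inserted into the tangent inequality
  at \<open>t\<close> it yields the claim.\<close>

lemma F_quadratic_growth:
  assumes "t \<ge> 1" shows "F (t * b) \<ge> t\<^sup>2 * F b"
proof -
  have "f b * b \<ge> 2 * F b" using F_ray_le[of 0 b] by simp
  then have "(t\<^sup>2 - 1) / 2 * (f b * b) \<ge> (t\<^sup>2 - 1) / 2 * (2 * F b)"
    using assms by (intro mult_left_mono) (auto simp: one_le_power)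
  moreover have "(t\<^sup>2 - 1) / 2 * (2 * F b) = t\<^sup>2 * F b - F b" by (simp add: field_simps)
  ultimately show ?thesis using F_ray_le[of t b] assms by linarith
qed

text \<open>A negative value \<open>F b\<close> would propagate down the ray: \<open>F (b / t) / (b / t)\<^sup>2\<close> would stay below a
  negative constant, against \<open>F u = o(u\<^sup>2)\<close> at 0.\<close>

lemma F_nonneg: "0 \<le> F b"
proof (rule ccontr)
  assume neg: "\<not> ?thesis"
  then have b: "b \<noteq> 0" by auto
  define \<epsilon> where "\<epsilon> = - F b / (2 * b\<^sup>2)"
  have "\<epsilon> > 0" using neg b by (auto simp: \<epsilon>_def intro!: divide_neg_pos)
  then obtain \<eta> where \<eta>: "\<eta> > 0" "\<And>u. \<bar>u\<bar> \<le> \<eta> \<Longrightarrow> \<bar>F u\<bar> \<le> \<epsilon> * u\<^sup>2"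
    using f_small by metis
  define t where "t = max 1 (\<bar>b\<bar> / \<eta>)"
  have t: "t \<ge> 1" "t * \<eta> \<ge> \<bar>b\<bar>" using \<eta>(1) by (auto simp: t_def max_def field_simps)
  have "\<bar>F (b / t)\<bar> \<le> \<epsilon> * (b / t)\<^sup>2"
    using t by (intro \<eta>(2)) (simp add: field_simps)
  then have "t\<^sup>2 * F (b / t) \<ge> t\<^sup>2 * (- (\<epsilon> * (b / t)\<^sup>2))" by (intro mult_left_mono) auto
  also have "t\<^sup>2 * (- (\<epsilon> * (b / t)\<^sup>2)) = F b / 2"
    using t b by (simp add: \<epsilon>_def power_divide)
  finally have "F b \<ge> F b / 2"
    using F_quadratic_growth[of t "b / t"] t by simp
  then show False using neg by simp
qed

text \<open>A modulus of continuity measured relative to the size of the arguments. An absolute error \<open>\<epsilon>\<close>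
  would not be square-summable over the lattice, whereas \<open>\<epsilon> * (\<bar>z\<bar> + \<bar>u\<bar>)\<close> is. Near 0 it comes from
  \<open>f u = o(u)\<close>, away from 0 from uniform continuity.\<close>

lemma f_relative_continuity:
  assumes "\<epsilon> > 0"
  obtains \<delta> where "\<delta> > 0"
    "\<And>u z. \<bar>u\<bar> \<le> M \<Longrightarrow> \<bar>z - u\<bar> \<le> \<delta> \<Longrightarrow> \<bar>f z - f u\<bar> \<le> \<epsilon> * (\<bar>z\<bar> + \<bar>u\<bar>)"
proof -
  obtain \<eta> where \<eta>: "\<eta> > 0" "\<And>u. \<bar>u\<bar> \<le> \<eta> \<Longrightarrow> \<bar>f u\<bar> \<le> \<epsilon> * \<bar>u\<bar>"
    using f_small[OF assms] by metis
  have "uniformly_continuous_on {-(M+1)..M+1} f"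
    by (intro compact_uniformly_continuous continuous_on_subset[OF cont_f]) auto
  then obtain d where d: "d > 0"
    "\<And>u z. u \<in> {-(M+1)..M+1} \<Longrightarrow> z \<in> {-(M+1)..M+1} \<Longrightarrow> \<bar>z - u\<bar> < d \<Longrightarrow> \<bar>f z - f u\<bar> < \<epsilon> * \<eta> / 2"
    unfolding uniformly_continuous_on_def dist_real_def
    using assms \<eta>(1) by (metis half_gt_zero mult_pos_pos)
  define \<delta> where "\<delta> = min (min 1 (d / 2)) (\<eta> / 2)"
  have "\<bar>f z - f u\<bar> \<le> \<epsilon> * (\<bar>z\<bar> + \<bar>u\<bar>)" if u: "\<bar>u\<bar> \<le> M" "\<bar>z - u\<bar> \<le> \<delta>" for u z
  proof (cases "\<bar>u\<bar> \<le> \<eta> / 2")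
    case True
    moreover have "\<bar>z - u\<bar> \<le> \<eta> / 2" using u by (simp add: \<delta>_def)
    moreover have "\<bar>z\<bar> \<le> \<bar>z - u\<bar> + \<bar>u\<bar>" by simp
    ultimately have "\<bar>u\<bar> \<le> \<eta>" "\<bar>z\<bar> \<le> \<eta>" using \<eta>(1) by linarith+
    then have "\<bar>f u\<bar> \<le> \<epsilon> * \<bar>u\<bar>" "\<bar>f z\<bar> \<le> \<epsilon> * \<bar>z\<bar>" by (auto intro: \<eta>(2))
    then show ?thesis by (simp add: algebra_simps)
  next
    case False
    have "\<bar>f z - f u\<bar> < \<epsilon> * \<eta> / 2"
      using u d(1) by (intro d(2)) (auto simp: \<delta>_def)
    also have "\<dots> = \<epsilon> * (\<eta> / 2)" by simp
    also have "\<dots> \<le> \<epsilon> * (\<bar>z\<bar> + \<bar>u\<bar>)" using False assms by (intro mult_left_mono) auto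
    finally show ?thesis by simp
  qed
  moreover have "\<delta> > 0" using d \<eta> by (simp add: \<delta>_def)
  ultimately show ?thesis using that by blast
qed

lemma F_superquadratic:
  obtains R where "R > 0" "\<And>u. \<bar>u\<bar> \<ge> R \<Longrightarrow> F u \<ge> A * u\<^sup>2"
proof -
  have "eventually (\<lambda>u. A \<le> F u / u\<^sup>2) at_infinity"
    using superquadratic by (simp add: filterlim_at_top)
  then obtain R where R: "\<And>u. \<bar>u\<bar> \<ge> R \<Longrightarrow> A \<le> F u / u\<^sup>2"
    unfolding eventually_at_infinity by auto
  have "F u \<ge> A * u\<^sup>2" if "\<bar>u\<bar> \<ge> max R 1" for u
  proof -
    have "u\<^sup>2 > 0" using that by auto
    then show ?thesis using R[of u] that by (simp add: field_simps)
  qed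
  then show ?thesis using that[of "max R 1"] by auto
qed

end

section \<open>Square-summable functions on the lattice\<close>

lemma infsum_dominated:
  fixes g h :: "'a \<Rightarrow> real"
  assumes "h summable_on A" "\<And>x. x \<in> A \<Longrightarrow> \<bar>g x\<bar> \<le> h x"
  shows "g summable_on A" "\<bar>infsum g A\<bar> \<le> infsum h A"
proof -
  have abs: "(\<lambda>x. norm (g x)) summable_on A"
    by (rule summable_on_comparison_test[OF assms(1)]) (use assms(2) in auto)
  then show "g summable_on A" by (rule abs_summable_summable)
  have "\<bar>infsum g A\<bar> \<le> infsum (\<lambda>x. norm (g x)) A"
    using norm_infsum_bound[OF abs] by simp
  also have "\<dots> \<le> infsum h A" by (rule infsum_mono[OF abs assms(1)]) (use assms(2) in auto)
  finally show "\<bar>infsum g A\<bar> \<le> infsum h A" .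
qed

lemma h1_prod_summable: "(\<lambda>x. h1_fun u x * h1_fun v x) summable_on UNIV"
  by (rule sqsum_mult) simp_all

lemma h1_abs_prod_summable: "(\<lambda>x. \<bar>h1_fun u x * h1_fun v x\<bar>) summable_on UNIV"
  using h1_prod_summable[of u v] summable_on_iff_abs_summable_on_real by fastforce

lemma h1_square_summable: "(\<lambda>x. (h1_fun u x)\<^sup>2) summable_on UNIV"
  using h1_prod_summable[of u u] by (simp add: power2_eq_square)

lemma h1_weighted_summable:
  assumes "\<And>x. \<bar>W x\<bar> \<le> K" shows "(\<lambda>x. W x * h1_fun u x * h1_fun v x) summable_on UNIV"
proof (rule infsum_dominated(1))
  show "(\<lambda>x. K * \<bar>h1_fun u x * h1_fun v x\<bar>) summable_on UNIV"
    by (intro summable_on_cmult_right h1_abs_prod_summable)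
  show "\<bar>W x * h1_fun u x * h1_fun v x\<bar> \<le> K * \<bar>h1_fun u x * h1_fun v x\<bar>" for x
    using mult_right_mono[OF assms[of x], of "\<bar>h1_fun u x * h1_fun v x\<bar>"]
    by (simp add: abs_mult mult.assoc)
qed

lemma h1_L2_set_le_norm: "finite A \<Longrightarrow> L2_set (h1_fun u) A \<le> norm u"
  unfolding L2_set_def by (rule real_le_lsqrt) (auto intro: h1_sum_le_norm sum_nonneg)

lemma h1_Cauchy_Schwarz: "(\<Sum>\<^sub>\<infinity>x. \<bar>h1_fun u x * h1_fun v x\<bar>) \<le> norm u * norm v"
proof (rule infsum_le_finite_sums[OF h1_abs_prod_summable])
  fix A :: "(int ^ 'a) set" assume A: "finite A"
  have "(\<Sum>x\<in>A. \<bar>h1_fun u x * h1_fun v x\<bar>) \<le> L2_set (h1_fun u) A * L2_set (h1_fun v) A"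
    using L2_set_mult_ineq[of "h1_fun u" "h1_fun v" A] by (simp add: abs_mult)
  also have "\<dots> \<le> norm u * norm v"
    using A by (intro mult_mono h1_L2_set_le_norm L2_set_nonneg) auto
  finally show "(\<Sum>x\<in>A. \<bar>h1_fun u x * h1_fun v x\<bar>) \<le> norm u * norm v" .
qed

text \<open>Fatou's lemma for finite partial sums. It lets pointwise convergence of bounded sequences take the
  place of weak convergence.\<close>

lemma h1_pointwise_limit:
  fixes w :: "nat \<Rightarrow> 'n::finite h1"
  assumes "\<And>n. norm (w n) \<le> L" "\<And>x. (\<lambda>n. h1_fun (w n) x) \<longlonglongrightarrow> g x"
  obtains W :: "'n h1" where "h1_fun W = g"
proof -
  have "(\<Sum>x\<in>A. (g x)\<^sup>2) \<le> L\<^sup>2" if "finite A" for A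
  proof (rule LIMSEQ_le_const2)
    show "(\<lambda>n. \<Sum>x\<in>A. (h1_fun (w n) x)\<^sup>2) \<longlonglongrightarrow> (\<Sum>x\<in>A. (g x)\<^sup>2)"
      by (intro tendsto_intros assms)
    have "(\<Sum>x\<in>A. (h1_fun (w n) x)\<^sup>2) \<le> L\<^sup>2" for n
      using h1_sum_le_norm[OF that, of "w n"] power_mono[OF assms(1)[of n], of 2] by simp
    then show "\<exists>N. \<forall>n\<ge>N. (\<Sum>x\<in>A. (h1_fun (w n) x)\<^sup>2) \<le> L\<^sup>2" by blast
  qed
  then have "sqsum g"
    unfolding sqsum_def by (intro nonneg_bdd_above_summable_on bdd_aboveI[of _ "L\<^sup>2"]) auto
  then show ?thesis using that[of "Abs_h1 g"] h1_fun_Abs by blast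
qed

text \<open>A bounded, pointwise null sequence is weakly null, even with absolute values inside the sum: the
  fixed function \<open>v\<close> has a small tail outside a finite set, and on that set the convergence is
  uniform.\<close>

lemma h1_weak_null:
  fixes z :: "nat \<Rightarrow> 'n::finite h1"
  assumes L: "\<And>n. norm (z n) \<le> L" and lim: "\<And>x. (\<lambda>n. h1_fun (z n) x) \<longlonglongrightarrow> 0"
  shows "(\<lambda>n. \<Sum>\<^sub>\<infinity>x. \<bar>h1_fun v x * h1_fun (z n) x\<bar>) \<longlonglongrightarrow> 0"
proof (rule LIMSEQ_I)
  fix r :: real assume r: "r > 0"
  have L0: "0 \<le> L" using L[of 0] norm_ge_zero order_trans by blast
  define e where "e = (r / (3 * (L + 1)))\<^sup>2"
  have e: "e > 0" using r L0 by (simp add: e_def)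
  obtain A where A: "finite A" "(\<Sum>\<^sub>\<infinity>x. (h1_fun v x)\<^sup>2) - (\<Sum>x\<in>A. (h1_fun v x)\<^sup>2) \<le> e"
    using infsum_finite_approximation[OF h1_square_summable[of v] e]
    by (auto simp: dist_real_def abs_le_iff)
  have tail: "(\<Sum>x\<in>B. (h1_fun v x)\<^sup>2) \<le> e" if "finite B" "B \<inter> A = {}" for B
  proof -
    have "(\<Sum>x\<in>A. (h1_fun v x)\<^sup>2) + (\<Sum>x\<in>B. (h1_fun v x)\<^sup>2) = (\<Sum>x\<in>A \<union> B. (h1_fun v x)\<^sup>2)"
      using A(1) that by (subst sum.union_disjoint) auto
    also have "\<dots> \<le> (\<Sum>\<^sub>\<infinity>x. (h1_fun v x)\<^sup>2)"
      using A(1) that by (intro finite_sum_le_infsum h1_square_summable) auto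
    finally show ?thesis using A(2) by linarith
  qed
  have "(\<lambda>n. \<Sum>x\<in>A. \<bar>h1_fun v x * h1_fun (z n) x\<bar>) \<longlonglongrightarrow> (\<Sum>x\<in>A. \<bar>h1_fun v x * 0\<bar>)"
    by (intro tendsto_intros lim)
  then obtain N where N: "\<And>n. n \<ge> N \<Longrightarrow> \<bar>\<Sum>x\<in>A. \<bar>h1_fun v x * h1_fun (z n) x\<bar>\<bar> < r / 3"
    using r by (fastforce dest!: LIMSEQ_D[of _ _ "r / 3"])
  have "norm ((\<Sum>\<^sub>\<infinity>x. \<bar>h1_fun v x * h1_fun (z n) x\<bar>) - 0) < r" if n: "n \<ge> N" for n
  proof -
    have "(\<Sum>\<^sub>\<infinity>x. \<bar>h1_fun v x * h1_fun (z n) x\<bar>) \<le> r / 3 + r / 3"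
    proof (rule infsum_le_finite_sums[OF h1_abs_prod_summable])
      fix B :: "(int ^ 'n) set" assume B: "finite B"
      have "(\<Sum>x\<in>B - A. \<bar>h1_fun v x * h1_fun (z n) x\<bar>)
          \<le> L2_set (h1_fun v) (B - A) * L2_set (h1_fun (z n)) (B - A)"
        using L2_set_mult_ineq[of "h1_fun v" "h1_fun (z n)" "B - A"] by (simp add: abs_mult)
      also have "\<dots> \<le> r / (3 * (L + 1)) * L"
      proof (intro mult_mono)
        show "L2_set (h1_fun v) (B - A) \<le> r / (3 * (L + 1))"
          unfolding L2_set_def using tail[of "B - A"] B r L0
          by (intro real_le_lsqrt) (auto simp: e_def intro: sum_nonneg)
        show "L2_set (h1_fun (z n)) (B - A) \<le> L"
          using h1_L2_set_le_norm[of "B - A" "z n"] B L[of n] by simp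
      qed (use r L0 in \<open>auto intro: L2_set_nonneg\<close>)
      also have "\<dots> \<le> r / 3" using r L0 by (simp add: field_simps)
      finally have 1: "(\<Sum>x\<in>B - A. \<bar>h1_fun v x * h1_fun (z n) x\<bar>) \<le> r / 3" .
      have "(\<Sum>x\<in>B. \<bar>h1_fun v x * h1_fun (z n) x\<bar>)
          \<le> (\<Sum>x\<in>A \<union> (B - A). \<bar>h1_fun v x * h1_fun (z n) x\<bar>)"
        using A B by (intro sum_mono2) auto
      also have "\<dots> = (\<Sum>x\<in>A. \<bar>h1_fun v x * h1_fun (z n) x\<bar>) + (\<Sum>x\<in>B - A. \<bar>h1_fun v x * h1_fun (z n) x\<bar>)"
        using A B by (intro sum.union_disjoint) auto
      also have "\<dots> \<le> r / 3 + r / 3" using 1 N[OF n] by linarith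
      finally show "(\<Sum>x\<in>B. \<bar>h1_fun v x * h1_fun (z n) x\<bar>) \<le> r / 3 + r / 3" .
    qed
    moreover have "0 \<le> (\<Sum>\<^sub>\<infinity>x. \<bar>h1_fun v x * h1_fun (z n) x\<bar>)" by (intro infsum_nonneg) auto
    ultimately show ?thesis using r by simp
  qed
  then show "\<exists>N. \<forall>n\<ge>N. norm ((\<Sum>\<^sub>\<infinity>x. \<bar>h1_fun v x * h1_fun (z n) x\<bar>) - 0) < r" by blast
qed

definition translate_h1 :: "int ^ 'n \<Rightarrow> 'n::finite h1 \<Rightarrow> 'n h1" where
  "translate_h1 k u = Abs_h1 (\<lambda>x. h1_fun u (x + k))"

lemma h1_fun_translate [simp]: "h1_fun (translate_h1 k u) x = h1_fun u (x + k)"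
  by (simp add: translate_h1_def h1_fun_Abs sqsum_translate)

lemma translate_scaleR: "translate_h1 k (s *\<^sub>R u) = s *\<^sub>R translate_h1 k u"
  by (rule h1_eqI) simp

lemma translate_neg [simp]: "translate_h1 (- k) (translate_h1 k u) = u"
  "translate_h1 k (translate_h1 (- k) u) = u"
  by (rule h1_eqI, simp)+

lemma infsum_translate: "(\<Sum>\<^sub>\<infinity>x. g (x + (k :: int ^ 'n::finite))) = (\<Sum>\<^sub>\<infinity>x. g x :: real)"
  using infsum_reindex_bij_betw[OF bij_translate[of k], of g] .

lemma sum_nbrs_translate:
  "(\<Sum>y\<in>nbrs x. g (y + k) (x + k)) = (\<Sum>y\<in>nbrs (x + k). g y (x + k))"
  unfolding sum_nbrs[of _ x] sum_nbrs[of _ "x + k"] by (simp only: add_ac)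

lemma norm_translate [simp]: "norm (translate_h1 k u) = norm u"
  unfolding norm_h1_def
  using infsum_translate[of "\<lambda>x. \<Sum>y\<in>nbrs x. (h1_fun u y - h1_fun u x)\<^sup>2" k]
    infsum_translate[of "\<lambda>x. (h1_fun u x)\<^sup>2" k]
  by (simp add: sum_nbrs_translate[of "\<lambda>y x. (h1_fun u y - h1_fun u x)\<^sup>2"])

lemma uminus_nbrs_0: "uminus ` nbrs (0 :: int ^ 'n::finite) = nbrs 0"
proof -
  have "- e \<in> nbrs 0" if "e \<in> nbrs (0 :: int ^ 'n)" for e using that by (simp add: nbrs_def)
  then show ?thesis by (metis (no_types, lifting) equation_minus_iff image_eqI image_subsetI subsetI subset_antisym)
qed

lemma sqsum_laplacian: "sqsum (laplacian (h1_fun u))"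
proof -
  have "sqsum (\<lambda>x. \<Sum>e\<in>E. h1_fun u (x + e) - h1_fun u x)" if "finite E" for E
    using that by induction (auto intro!: sqsum_add sqsum_diff sqsum_translate sqsum_zero)
  moreover have "laplacian (h1_fun u) = (\<lambda>x. \<Sum>e\<in>nbrs 0. h1_fun u (x + e) - h1_fun u x)"
    unfolding laplacian_def by (intro ext sum_nbrs)
  ultimately show ?thesis by simp
qed

text \<open>Summation by parts. For each direction \<open>e\<close> a shift of the summation index turns the product of
  differences into differences of \<open>u\<close> in the directions \<open>e\<close> and \<open>- e\<close>, and the set of directions is
  symmetric.\<close>

lemma Green_identity:
  fixes u v :: "'n::finite h1"
  shows "inner u v = (\<Sum>\<^sub>\<infinity>x. (h1_fun u x - laplacian (h1_fun u) x) * h1_fun v x)"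
proof -
  let ?u = "h1_fun u" and ?v = "h1_fun v" and ?E = "nbrs (0 :: int ^ 'n)"
  have s: "(\<lambda>x. ?u (x + b) * ?v (x + c)) summable_on UNIV" for b c
    by (intro sqsum_mult sqsum_translate) auto
  have s': "(\<lambda>x. (?u (x + b) - ?u (x + c)) * ?v (x + d)) summable_on UNIV" for b c d
    by (intro sqsum_mult sqsum_diff sqsum_translate) auto
  let ?I = "\<lambda>e. \<Sum>\<^sub>\<infinity>x. (?u x - ?u (x + e)) * ?v x"
  have e: "(\<Sum>\<^sub>\<infinity>x. (?u (x + e) - ?u x) * (?v (x + e) - ?v x)) = ?I (- e) + ?I e" for e
  proof -
    have "(\<Sum>\<^sub>\<infinity>x. (?u (x + e) - ?u x) * (?v (x + e) - ?v x))
        = (\<Sum>\<^sub>\<infinity>x. (?u (x + e) - ?u x) * ?v (x + e) + (?u x - ?u (x + e)) * ?v x)"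
      by (simp add: algebra_simps)
    also have "\<dots> = (\<Sum>\<^sub>\<infinity>x. (?u (x + e) - ?u x) * ?v (x + e)) + ?I e"
      using s'[of e 0 e] s'[of 0 e 0] by (intro infsum_add) auto
    also have "(\<Sum>\<^sub>\<infinity>x. (?u (x + e) - ?u x) * ?v (x + e)) = ?I (- e)"
      using infsum_translate[of "\<lambda>x. (?u x - ?u (x + - e)) * ?v x" e] by simp
    finally show ?thesis .
  qed
  have sd: "(\<lambda>x. (?u (x + e) - ?u x) * (?v (x + e) - ?v x)) summable_on UNIV" for e
    by (intro sqsum_mult sqsum_diff sqsum_translate) auto
  have "(\<Sum>\<^sub>\<infinity>x. \<Sum>y\<in>nbrs x. (?u y - ?u x) * (?v y - ?v x))
      = (\<Sum>\<^sub>\<infinity>x. \<Sum>e\<in>?E. (?u (x + e) - ?u x) * (?v (x + e) - ?v x))"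
    by (intro infsum_cong sum_nbrs)
  also have "\<dots> = (\<Sum>e\<in>?E. ?I (- e) + ?I e)"
    by (simp add: summable_on_finite_sum(2) sd e)
  also have "\<dots> = (\<Sum>e\<in>?E. ?I (- e)) + (\<Sum>e\<in>?E. ?I e)" by (simp add: sum.distrib)
  also have "(\<Sum>e\<in>?E. ?I (- e)) = (\<Sum>e\<in>uminus ` ?E. ?I e)" by (subst sum.reindex) auto
  also have "\<dots> + (\<Sum>e\<in>?E. ?I e) = 2 * (\<Sum>e\<in>?E. ?I e)" unfolding uminus_nbrs_0 by simp
  also have "(\<Sum>e\<in>?E. ?I e) = (\<Sum>\<^sub>\<infinity>x. \<Sum>e\<in>?E. (?u x - ?u (x + e)) * ?v x)"
    using s'[of 0 _ 0] by (intro summable_on_finite_sum(2)[symmetric]) auto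
  also have "\<dots> = (\<Sum>\<^sub>\<infinity>x. - laplacian ?u x * ?v x)"
  proof (intro infsum_cong)
    fix x
    have "laplacian ?u x = (\<Sum>e\<in>?E. ?u (x + e) - ?u x)"
      unfolding laplacian_def by (rule sum_nbrs)
    then have "- laplacian ?u x = (\<Sum>e\<in>?E. ?u x - ?u (x + e))"
      by (simp only: sum_negf[symmetric] minus_diff_eq)
    then show "(\<Sum>e\<in>?E. (?u x - ?u (x + e)) * ?v x) = - laplacian ?u x * ?v x"
      by (simp only: sum_distrib_right)
  qed
  finally have g: "(\<Sum>\<^sub>\<infinity>x. \<Sum>y\<in>nbrs x. (?u y - ?u x) * (?v y - ?v x))
      = 2 * (\<Sum>\<^sub>\<infinity>x. - laplacian ?u x * ?v x)" .
  have "(\<lambda>x. - laplacian ?u x * ?v x) summable_on UNIV"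
    using sqsum_mult[OF sqsum_laplacian[of u] sqsum_h1[of v]] by (simp add: summable_on_uminus)
  then have "(\<Sum>\<^sub>\<infinity>x. - laplacian ?u x * ?v x + ?u x * ?v x)
      = (\<Sum>\<^sub>\<infinity>x. - laplacian ?u x * ?v x) + (\<Sum>\<^sub>\<infinity>x. ?u x * ?v x)"
    by (intro infsum_add h1_prod_summable)
  moreover have "(\<lambda>x. - laplacian ?u x * ?v x + ?u x * ?v x) = (\<lambda>x. (?u x - laplacian ?u x) * ?v x)"
    by (simp add: fun_eq_iff algebra_simps)
  ultimately show ?thesis by (simp only: inner_h1_def g)
qed

lemma lattice_ball_finite: "finite {x :: int ^ 'n::finite. lattice_norm x \<le> R}"
proof (rule finite_subset)
  let ?P = "PiE UNIV (\<lambda>i :: 'n. {- R..R})"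
  show "finite (vec_lambda ` ?P)" by (intro finite_imageI finite_PiE) auto
  show "{x. lattice_norm x \<le> R} \<subseteq> vec_lambda ` ?P"
  proof
    fix x :: "int ^ 'n" assume x: "x \<in> {x. lattice_norm x \<le> R}"
    have "\<bar>x $ i\<bar> \<le> lattice_norm x" for i
      unfolding lattice_norm_def by (rule member_le_sum) auto
    then have "\<bar>x $ i\<bar> \<le> R" for i using x by (metis mem_Collect_eq order_trans)
    then have "vec_nth x \<in> ?P"
      by (auto simp: PiE_UNIV_domain abs_le_iff minus_le_iff)
    then show "x \<in> vec_lambda ` ?P" by (metis image_eqI vec_nth_inverse)
  qed
qed

text \<open>A sequence of lattice points that takes each value finitely often leaves every ball, because balls
  are finite.\<close>

lemma lattice_norm_tendsto:
  fixes k :: "nat \<Rightarrow> int ^ 'n::finite"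
  assumes "\<And>y. finite {n. k n = y}"
  shows "filterlim (\<lambda>n. lattice_norm (x + k n)) at_top sequentially"
  unfolding filterlim_at_top
proof
  fix R :: int
  let ?B = "{y :: int ^ 'n. lattice_norm y \<le> R}"
  have "finite (\<Union>y\<in>?B. {n. k n = y - x})"
    using lattice_ball_finite assms by blast
  moreover have "{n. \<not> R \<le> lattice_norm (x + k n)} \<subseteq> (\<Union>y\<in>?B. {n. k n = y - x})"
  proof
    fix n assume "n \<in> {n. \<not> R \<le> lattice_norm (x + k n)}"
    then have "x + k n \<in> ?B" "k n = (x + k n) - x" by auto
    then show "n \<in> (\<Union>y\<in>?B. {n. k n = y - x})" by blast
  qed
  ultimately have "finite {n. \<not> R \<le> lattice_norm (x + k n)}" by (rule finite_subset[rotated])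
  then show "eventually (\<lambda>n. R \<le> lattice_norm (x + k n)) sequentially"
    by (simp add: cofinite_eq_sequentially[symmetric] eventually_cofinite)
qed

section \<open>The energy\<close>

text \<open>The constants bound all potentials under consideration: the given one, its translates and its value
  at infinity. Having \<open>1\<close> between them makes the quadratic part of the energy comparable to the
  \<open>H\<^sup>1\<close> norm with the constant \<open>\<alpha>\<close>, without separating the gradient from the mass term.\<close>

locale lattice_energy = superquadratic_nonlinearity +
  fixes \<alpha> \<beta> :: real
  assumes \<alpha>: "0 < \<alpha>" "\<alpha> \<le> 1" and \<beta>: "1 \<le> \<beta>"
begin

definition potential :: "(int ^ 'n::finite \<Rightarrow> real) \<Rightarrow> bool" where
  "potential V \<longleftrightarrow> (\<forall>x. \<alpha> \<le> V x \<and> V x \<le> \<beta>)"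

text \<open>The symmetric bilinear form of \<open>- \<Delta> + V\<close>, written as a perturbation of the \<open>H\<^sup>1\<close> inner product.\<close>

definition form :: "(int ^ 'n \<Rightarrow> real) \<Rightarrow> 'n::finite h1 \<Rightarrow> 'n h1 \<Rightarrow> real" where
  "form V u v = inner u v + (\<Sum>\<^sub>\<infinity>x. (V x - 1) * h1_fun u x * h1_fun v x)"

abbreviation E :: "(int ^ 'n \<Rightarrow> real) \<Rightarrow> 'n::finite h1 \<Rightarrow> real" where
  "E V \<equiv> energy V f"

text \<open>The candidate for the Frechet derivative of the energy at \<open>u\<close>.\<close>

definition dE :: "(int ^ 'n \<Rightarrow> real) \<Rightarrow> 'n::finite h1 \<Rightarrow> 'n h1 \<Rightarrow> real" where
  "dE V u h = form V u h - (\<Sum>\<^sub>\<infinity>x. f (h1_fun u x) * h1_fun h x)"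

lemma potential_bounded: "potential V \<Longrightarrow> \<bar>V x - 1\<bar> \<le> \<beta>"
  using \<alpha> \<beta> unfolding potential_def by (smt (verit))

lemma potential_summable:
  "potential V \<Longrightarrow> (\<lambda>x. (V x - 1) * h1_fun u x * h1_fun v x) summable_on UNIV"
  by (rule h1_weighted_summable[where K = \<beta>]) (rule potential_bounded)

lemma form_commute: "form V u v = form V v u"
  by (simp add: form_def inner_commute ac_simps)

lemma form_add_right: "potential V \<Longrightarrow> form V u (v + w) = form V u v + form V u w"
  using infsum_add[OF potential_summable[of V u v] potential_summable[of V u w]]
  by (simp add: form_def inner_add_right distrib_left)

lemma form_scaleR_right: "potential V \<Longrightarrow> form V u (c *\<^sub>R v) = c * form V u v"
  using infsum_cmult_right[OF potential_summable[of V u v], of c]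
  by (simp add: form_def distrib_left mult.left_commute)

lemma form_add_left: "potential V \<Longrightarrow> form V (v + w) u = form V v u + form V w u"
  and form_scaleR_left: "potential V \<Longrightarrow> form V (c *\<^sub>R v) u = c * form V v u"
  by (simp_all add: form_commute[of V _ u] form_add_right form_scaleR_right)

lemma form_abs_le: assumes "potential V" shows "\<bar>form V u v\<bar> \<le> (1 + \<beta>) * (norm u * norm v)"
proof -
  have "\<bar>\<Sum>\<^sub>\<infinity>x. (V x - 1) * h1_fun u x * h1_fun v x\<bar> \<le> (\<Sum>\<^sub>\<infinity>x. \<beta> * \<bar>h1_fun u x * h1_fun v x\<bar>)"
    using potential_bounded[OF assms]
    by (intro infsum_dominated(2) summable_on_cmult_right h1_abs_prod_summable)
       (auto simp: abs_mult mult.assoc intro!: mult_right_mono)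
  also have "\<dots> = \<beta> * (\<Sum>\<^sub>\<infinity>x. \<bar>h1_fun u x * h1_fun v x\<bar>)"
    by (intro infsum_cmult_right h1_abs_prod_summable)
  also have "\<dots> \<le> \<beta> * (norm u * norm v)"
    using \<beta> by (intro mult_left_mono h1_Cauchy_Schwarz) auto
  finally show ?thesis
    using Cauchy_Schwarz_ineq2[of u v] unfolding form_def by (simp add: algebra_simps)
qed

lemma form_ge: assumes "potential V" shows "\<alpha> * (norm u)\<^sup>2 \<le> form V u u"
proof -
  have "(\<alpha> - 1) * (\<Sum>\<^sub>\<infinity>x. (h1_fun u x)\<^sup>2) = (\<Sum>\<^sub>\<infinity>x. (\<alpha> - 1) * (h1_fun u x)\<^sup>2)"
    by (intro infsum_cmult_right[symmetric] h1_square_summable)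
  also have "\<dots> \<le> (\<Sum>\<^sub>\<infinity>x. (V x - 1) * h1_fun u x * h1_fun u x)"
    using assms unfolding potential_def
    by (intro infsum_mono summable_on_cmult_right h1_square_summable potential_summable assms)
       (auto simp: power2_eq_square mult.assoc intro!: mult_right_mono)
  finally have 1: "(\<alpha> - 1) * (\<Sum>\<^sub>\<infinity>x. (h1_fun u x)\<^sup>2) \<le> (\<Sum>\<^sub>\<infinity>x. (V x - 1) * h1_fun u x * h1_fun u x)" .
  have "(\<alpha> - 1) * (norm u)\<^sup>2 \<le> (\<alpha> - 1) * (\<Sum>\<^sub>\<infinity>x. (h1_fun u x)\<^sup>2)"
    using \<alpha> h1_l2_le_norm[of u] by (intro mult_left_mono_neg) auto
  then show ?thesis
    using 1 by (simp add: form_def power2_norm_eq_inner algebra_simps)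
qed

lemma F_summable: "(\<lambda>x. F (h1_fun u x)) summable_on UNIV"
proof (rule infsum_dominated(1))
  show "(\<lambda>x. 2 * lin_bound (3 * norm u) * (h1_fun u x)\<^sup>2) summable_on UNIV"
    by (intro summable_on_cmult_right h1_square_summable)
qed (auto intro!: F_quadratic_bound h1_fun_le_norm)

lemma f_prod_summable: "(\<lambda>x. f (h1_fun u x) * h1_fun v x) summable_on UNIV"
proof (rule infsum_dominated(1))
  show "(\<lambda>x. lin_bound (norm u) * \<bar>h1_fun u x * h1_fun v x\<bar>) summable_on UNIV"
    by (intro summable_on_cmult_right h1_abs_prod_summable)
  show "\<bar>f (h1_fun u x) * h1_fun v x\<bar> \<le> lin_bound (norm u) * \<bar>h1_fun u x * h1_fun v x\<bar>" for x
    using f_lin_bound[OF h1_fun_le_norm[of u x]]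
    by (simp add: abs_mult mult.assoc[symmetric] mult_right_mono)
qed

lemma energy_eq:
  assumes "potential V"
  shows "E V u = form V u u / 2 - (\<Sum>\<^sub>\<infinity>x. F (h1_fun u x))"
proof -
  let ?u = "h1_fun u"
  have s1: "(\<lambda>x. (1/2) * (\<Sum>y\<in>nbrs x. (?u y - ?u x)\<^sup>2)) summable_on UNIV"
    using grad_prod_summable[OF sqsum_h1 sqsum_h1, of u u]
    by (intro summable_on_cmult_right) (simp add: power2_eq_square)
  have s3: "(\<lambda>x. (V x - 1) * ?u x * ?u x + ?u x * ?u x) summable_on UNIV"
    by (intro summable_on_add potential_summable h1_prod_summable assms)
  have "(\<Sum>\<^sub>\<infinity>x. (1/2) * (\<Sum>y\<in>nbrs x. (?u y - ?u x)\<^sup>2) + V x * (?u x)\<^sup>2)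
     = (\<Sum>\<^sub>\<infinity>x. (1/2) * (\<Sum>y\<in>nbrs x. (?u y - ?u x)\<^sup>2) + ((V x - 1) * ?u x * ?u x + ?u x * ?u x))"
    by (simp add: algebra_simps power2_eq_square)
  also have "\<dots> = (\<Sum>\<^sub>\<infinity>x. (1/2) * (\<Sum>y\<in>nbrs x. (?u y - ?u x)\<^sup>2))
      + ((\<Sum>\<^sub>\<infinity>x. (V x - 1) * ?u x * ?u x) + (\<Sum>\<^sub>\<infinity>x. ?u x * ?u x))"
    using infsum_add[OF potential_summable[OF assms, of u u] h1_prod_summable[of u u]]
    by (simp only: infsum_add[OF s1 s3])
  also have "(\<Sum>\<^sub>\<infinity>x. (1/2) * (\<Sum>y\<in>nbrs x. (?u y - ?u x)\<^sup>2))
      = (1/2) * (\<Sum>\<^sub>\<infinity>x. (\<Sum>y\<in>nbrs x. (?u y - ?u x) * (?u y - ?u x)))"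
    using grad_prod_summable[OF sqsum_h1 sqsum_h1, of u u]
    by (subst infsum_cmult_right) (auto simp: power2_eq_square)
  finally show ?thesis
    by (simp add: energy_def form_def inner_h1_def)
qed

lemma energy_0 [simp]: "E V 0 = 0"
  by (simp add: energy_def)

lemma dE_weak_form:
  assumes "potential V"
  shows "dE V u h = (\<Sum>\<^sub>\<infinity>x. (- laplacian (h1_fun u) x + V x * h1_fun u x - f (h1_fun u x)) * h1_fun h x)"
proof -
  let ?u = "h1_fun u" and ?h = "h1_fun h"
  have s1: "(\<lambda>x. (?u x - laplacian ?u x) * ?h x) summable_on UNIV"
    by (intro sqsum_mult sqsum_diff sqsum_laplacian) auto
  note s2 = potential_summable[OF assms, of u h] and s3 = f_prod_summable[of u h]
  have "(\<Sum>\<^sub>\<infinity>x. (- laplacian ?u x + V x * ?u x - f (?u x)) * ?h x)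
      = (\<Sum>\<^sub>\<infinity>x. ((?u x - laplacian ?u x) * ?h x + (V x - 1) * ?u x * ?h x) + - (f (?u x) * ?h x))"
    by (simp add: algebra_simps)
  also have "\<dots> = form V u h - (\<Sum>\<^sub>\<infinity>x. f (?u x) * ?h x)"
    using s3 by (simp only: infsum_add s1 s2 summable_on_add summable_on_uminus infsum_uminus
        form_def Green_identity)
  finally show ?thesis by (simp add: dE_def)
qed

lemma dE_add: "potential V \<Longrightarrow> dE V u (g + h) = dE V u g + dE V u h"
  using infsum_add[OF f_prod_summable[of u g] f_prod_summable[of u h]]
  by (simp add: dE_def form_add_right distrib_left)

lemma dE_scaleR: "potential V \<Longrightarrow> dE V u (c *\<^sub>R h) = c * dE V u h"
  using infsum_cmult_right[OF f_prod_summable[of u h], of c]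
  by (simp add: dE_def form_scaleR_right right_diff_distrib mult.left_commute)

lemma dE_abs_le:
  assumes "potential V" shows "\<bar>dE V u h\<bar> \<le> norm h * ((1 + \<beta> + lin_bound (norm u)) * norm u)"
proof -
  have "\<bar>\<Sum>\<^sub>\<infinity>x. f (h1_fun u x) * h1_fun h x\<bar> \<le> (\<Sum>\<^sub>\<infinity>x. lin_bound (norm u) * \<bar>h1_fun u x * h1_fun h x\<bar>)"
    using f_lin_bound[OF h1_fun_le_norm[of u]]
    by (intro infsum_dominated(2) summable_on_cmult_right h1_abs_prod_summable)
       (simp add: abs_mult mult.assoc[symmetric] mult_right_mono)
  also have "\<dots> = lin_bound (norm u) * (\<Sum>\<^sub>\<infinity>x. \<bar>h1_fun u x * h1_fun h x\<bar>)"
    by (intro infsum_cmult_right h1_abs_prod_summable)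
  also have "\<dots> \<le> lin_bound (norm u) * (norm u * norm h)"
    by (intro mult_left_mono h1_Cauchy_Schwarz lin_bound_nonneg)
  finally show ?thesis
    using form_abs_le[OF assms, of u h] unfolding dE_def by (simp add: algebra_simps)
qed

text \<open>Strict differentiability at \<open>u\<close>: the linear approximation is uniform over pairs of points near \<open>u\<close>.
  Pointwise the error is \<open>(f z - f u) * (w - v)\<close> for an intermediate value \<open>z\<close>, which relative
  continuity of \<open>f\<close> and the Cauchy--Schwarz inequality sum up to \<open>\<epsilon> * norm (w - v)\<close>.\<close>

lemma F_sum_strict_derivative:
  fixes u :: "'n::finite h1"
  assumes "\<epsilon> > 0"
  obtains \<delta> where "\<delta> > 0" "\<And>v w :: 'n h1. norm (v - u) \<le> \<delta> \<Longrightarrow> norm (w - u) \<le> \<delta> \<Longrightarrow>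
    \<bar>(\<Sum>\<^sub>\<infinity>x. F (h1_fun w x)) - (\<Sum>\<^sub>\<infinity>x. F (h1_fun v x)) - (\<Sum>\<^sub>\<infinity>x. f (h1_fun u x) * h1_fun (w - v) x)\<bar>
      \<le> \<epsilon> * norm (w - v)"
proof -
  define \<epsilon>' where "\<epsilon>' = \<epsilon> / (2 * norm u + 2)"
  have \<epsilon>': "\<epsilon>' > 0" using assms by (simp add: \<epsilon>'_def add_nonneg_pos)
  obtain d where d: "d > 0" "\<And>r z. \<bar>r\<bar> \<le> norm u \<Longrightarrow> \<bar>z - r\<bar> \<le> d \<Longrightarrow> \<bar>f z - f r\<bar> \<le> \<epsilon>' * (\<bar>z\<bar> + \<bar>r\<bar>)"
    using f_relative_continuity[OF \<epsilon>', of "norm u"] by metis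
  \<comment> \<open>Halved because the intermediate value is within the sum of two distances of at most \<open>\<delta>\<close>.\<close>
  define \<delta> where "\<delta> = min (d / 2) (1 / 2)"
  have \<delta>: "\<delta> > 0" "2 * \<delta> \<le> d" "2 * \<delta> \<le> 1" using d by (auto simp: \<delta>_def)
  show ?thesis
  proof (rule that[OF \<delta>(1)])
    fix v w :: "'n h1"
    assume vw: "norm (v - u) \<le> \<delta>" "norm (w - u) \<le> \<delta>"
    let ?D = "\<lambda>x. F (h1_fun w x) - F (h1_fun v x) - f (h1_fun u x) * h1_fun (w - v) x"
    let ?P = "\<lambda>p x. \<bar>h1_fun p x * h1_fun (w - v) x\<bar>"
    let ?B = "\<lambda>x. \<epsilon>' * (2 * ?P u x + (?P (v - u) x + ?P (w - u) x))"
    have ptw: "\<bar>?D x\<bar> \<le> ?B x" for x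
    proof -
      define r s t where "r = h1_fun u x" "s = h1_fun v x" "t = h1_fun w x"
      obtain z where z: "\<bar>z - s\<bar> \<le> \<bar>t - s\<bar>" "\<bar>z - t\<bar> \<le> \<bar>t - s\<bar>" "F t - F s = f z * (t - s)"
        using F_mean_value by blast
      have st: "\<bar>s - r\<bar> \<le> \<delta>" "\<bar>t - r\<bar> \<le> \<delta>"
        using h1_fun_le_norm[of "v - u" x] h1_fun_le_norm[of "w - u" x] vw by (simp_all add: r_s_t_def)
      have zr: "\<bar>z - r\<bar> \<le> \<bar>s - r\<bar> + \<bar>t - r\<bar>" using z(1,2) by (smt (verit))
      then have "\<bar>z - r\<bar> \<le> d" using st \<delta> by linarith
      then have "\<bar>f z - f r\<bar> \<le> \<epsilon>' * (\<bar>z\<bar> + \<bar>r\<bar>)"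
        using d(2)[of r z] h1_fun_le_norm[of u x] by (simp add: r_s_t_def)
      also have "\<dots> \<le> \<epsilon>' * (2 * \<bar>r\<bar> + (\<bar>s - r\<bar> + \<bar>t - r\<bar>))"
        using zr \<epsilon>' by (intro mult_left_mono) (smt (verit), simp)
      finally have "\<bar>f z - f r\<bar> * \<bar>t - s\<bar> \<le> \<epsilon>' * (2 * \<bar>r\<bar> + (\<bar>s - r\<bar> + \<bar>t - r\<bar>)) * \<bar>t - s\<bar>"
        by (rule mult_right_mono) simp
      moreover have "F t - F s - f r * (t - s) = (f z - f r) * (t - s)"
        using z(3) by (simp add: algebra_simps)
      ultimately have "\<bar>F t - F s - f r * (t - s)\<bar>
          \<le> \<epsilon>' * (2 * (\<bar>r\<bar> * \<bar>t - s\<bar>) + (\<bar>s - r\<bar> * \<bar>t - s\<bar> + \<bar>t - r\<bar> * \<bar>t - s\<bar>))"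
        by (simp only: abs_mult distrib_right mult.assoc)
      then show ?thesis by (simp only: r_s_t_def abs_mult h1_fun_simps)
    qed
    have P\<delta>: "infsum (?P p) UNIV \<le> \<delta> * norm (w - v)" if "norm p \<le> \<delta>" for p
      by (rule order_trans[OF h1_Cauchy_Schwarz]) (intro mult_right_mono that norm_ge_zero)
    have sP: "?P p summable_on UNIV" for p by (rule h1_abs_prod_summable)
    have sB: "?B summable_on UNIV"
      by (intro summable_on_cmult_right summable_on_add sP)
    have "(\<Sum>\<^sub>\<infinity>x. F (h1_fun w x)) - (\<Sum>\<^sub>\<infinity>x. F (h1_fun v x)) - (\<Sum>\<^sub>\<infinity>x. f (h1_fun u x) * h1_fun (w - v) x)
        = infsum ?D UNIV"
    proof -
      have "infsum ?D UNIV = (\<Sum>\<^sub>\<infinity>x. F (h1_fun w x) + - F (h1_fun v x) + - (f (h1_fun u x) * h1_fun (w - v) x))"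
        by simp
      also have "\<dots> = (\<Sum>\<^sub>\<infinity>x. F (h1_fun w x)) + - (\<Sum>\<^sub>\<infinity>x. F (h1_fun v x)) + - (\<Sum>\<^sub>\<infinity>x. f (h1_fun u x) * h1_fun (w - v) x)"
        using F_summable[of w] F_summable[of v] f_prod_summable[of u "w - v"]
        by (simp only: infsum_add summable_on_add summable_on_uminus infsum_uminus)
      finally show ?thesis by simp
    qed
    then have "\<bar>(\<Sum>\<^sub>\<infinity>x. F (h1_fun w x)) - (\<Sum>\<^sub>\<infinity>x. F (h1_fun v x)) - (\<Sum>\<^sub>\<infinity>x. f (h1_fun u x) * h1_fun (w - v) x)\<bar>
        \<le> infsum ?B UNIV"
      using infsum_dominated(2)[OF sB ptw] by simp
    also have "infsum ?B UNIV = \<epsilon>' * (2 * infsum (?P u) UNIV + (infsum (?P (v - u)) UNIV + infsum (?P (w - u)) UNIV))"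
      by (simp only: infsum_add infsum_cmult_right summable_on_cmult_right summable_on_add sP)
    also have "\<dots> \<le> \<epsilon>' * (2 * (norm u * norm (w - v)) + (\<delta> * norm (w - v) + \<delta> * norm (w - v)))"
      using \<epsilon>' by (intro mult_left_mono add_mono h1_Cauchy_Schwarz P\<delta> vw) auto
    also have "\<dots> = \<epsilon>' * (2 * norm u + 2 * \<delta>) * norm (w - v)" by (simp add: algebra_simps)
    also have "\<dots> \<le> \<epsilon>' * (2 * norm u + 2) * norm (w - v)"
      using \<delta> \<epsilon>' by (intro mult_right_mono mult_left_mono) auto
    also have "\<epsilon>' * (2 * norm u + 2) = \<epsilon>'* (norm u * 2 + 2)" by simp
    also have "\<dots> = \<epsilon>" using norm_ge_zero[of u] by (simp add: \<epsilon>'_def field_simps add_nonneg_eq_0_iff)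
    finally show "\<bar>(\<Sum>\<^sub>\<infinity>x. F (h1_fun w x)) - (\<Sum>\<^sub>\<infinity>x. F (h1_fun v x)) - (\<Sum>\<^sub>\<infinity>x. f (h1_fun u x) * h1_fun (w - v) x)\<bar>
      \<le> \<epsilon> * norm (w - v)" .
  qed
qed

text \<open>Strictness is needed below to compare the energy at two points of which neither is \<open>u\<close>.\<close>

lemma energy_strict_derivative:
  fixes u :: "'n::finite h1"
  assumes V: "potential V" and \<epsilon>: "\<epsilon> > 0"
  obtains \<delta> where "\<delta> > 0" "\<And>v w. norm (v - u) \<le> \<delta> \<Longrightarrow> norm (w - u) \<le> \<delta> \<Longrightarrow>
    \<bar>E V w - E V v - dE V u (w - v)\<bar> \<le> \<epsilon> * norm (w - v)"
proof -
  obtain d where d: "d > 0" "\<And>v w :: 'n h1. norm (v - u) \<le> d \<Longrightarrow> norm (w - u) \<le> d \<Longrightarrow>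
    \<bar>(\<Sum>\<^sub>\<infinity>x. F (h1_fun w x)) - (\<Sum>\<^sub>\<infinity>x. F (h1_fun v x)) - (\<Sum>\<^sub>\<infinity>x. f (h1_fun u x) * h1_fun (w - v) x)\<bar>
      \<le> \<epsilon> / 2 * norm (w - v)"
    using F_sum_strict_derivative[of "\<epsilon> / 2" u] \<epsilon> by auto
  define \<delta> where "\<delta> = min d (\<epsilon> / (2 * (1 + \<beta>)))"
  have \<delta>: "\<delta> > 0" "\<delta> \<le> d" "(1 + \<beta>) * \<delta> \<le> \<epsilon> / 2"
  proof -
    show "\<delta> > 0" "\<delta> \<le> d" using d(1) \<epsilon> \<beta> by (simp_all add: \<delta>_def)
    have "(1 + \<beta>) * \<delta> \<le> (1 + \<beta>) * (\<epsilon> / (2 * (1 + \<beta>)))"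
      using \<beta> by (intro mult_left_mono) (auto simp: \<delta>_def)
    also have "\<dots> = \<epsilon> / 2" using \<beta> nonzero_mult_divide_mult_cancel_left[of "1 + \<beta>" \<epsilon> 2]
      by (simp only: times_divide_eq_right mult.commute[of 2])
    finally show "(1 + \<beta>) * \<delta> \<le> \<epsilon> / 2" .
  qed
  show ?thesis
  proof (rule that[OF \<delta>(1)])
    fix v w :: "'n h1" assume vw: "norm (v - u) \<le> \<delta>" "norm (w - u) \<le> \<delta>"
    define p h where "p = v - u" and "h = w - v"
    have v: "v = u + p" and w: "w = u + (p + h)" by (simp_all add: p_def h_def)
    have "form V w w / 2 - form V v v / 2 - form V u h = (form V p h + form V (w - u) h) / 2"
      using form_commute[of V p u] form_commute[of V h u] form_commute[of V h p]
      unfolding w v by (simp add: form_add_left[OF V] form_add_right[OF V] field_simps)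
    moreover have "\<bar>form V p h\<bar> \<le> \<epsilon> / 2 * norm h" "\<bar>form V (w - u) h\<bar> \<le> \<epsilon> / 2 * norm h"
    proof -
      have "\<bar>form V r h\<bar> \<le> \<epsilon> / 2 * norm h" if "norm r \<le> \<delta>" for r
      proof -
        have "\<bar>form V r h\<bar> \<le> (1 + \<beta>) * (norm r * norm h)" by (rule form_abs_le[OF V])
        also have "\<dots> \<le> (1 + \<beta>) * (\<delta> * norm h)"
          using that \<beta> by (intro mult_left_mono mult_right_mono) auto
        also have "\<dots> = ((1 + \<beta>) * \<delta>) * norm h" by simp
        also have "\<dots> \<le> \<epsilon> / 2 * norm h" using \<delta>(3) by (rule mult_right_mono) simp
        finally show ?thesis .
      qed
      then show "\<bar>form V p h\<bar> \<le> \<epsilon> / 2 * norm h" "\<bar>form V (w - u) h\<bar> \<le> \<epsilon> / 2 * norm h"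
        using vw by (simp_all add: p_def)
    qed
    moreover have "\<bar>r\<bar> \<le> c" if "r = (s + t) / 2" "\<bar>s\<bar> \<le> c" "\<bar>t\<bar> \<le> c" for r s t c :: real
      using that unfolding abs_le_iff by auto
    ultimately have "\<bar>form V w w / 2 - form V v v / 2 - form V u h\<bar> \<le> \<epsilon> / 2 * norm h"
      by blast
    moreover have "\<bar>(\<Sum>\<^sub>\<infinity>x. F (h1_fun w x)) - (\<Sum>\<^sub>\<infinity>x. F (h1_fun v x)) - (\<Sum>\<^sub>\<infinity>x. f (h1_fun u x) * h1_fun h x)\<bar>
      \<le> \<epsilon> / 2 * norm h"
      unfolding h_def using d(2) vw \<delta>(2) by (meson order_trans)
    ultimately show "\<bar>E V w - E V v - dE V u (w - v)\<bar> \<le> \<epsilon> * norm (w - v)"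
      unfolding energy_eq[OF V] dE_def h_def[symmetric] abs_le_iff by auto
  qed
qed

lemma bounded_linear_dE: "potential V \<Longrightarrow> bounded_linear (dE V u)"
  by (rule bounded_linear_intro[where K = "(1 + \<beta> + lin_bound (norm u)) * norm u"])
     (simp_all add: dE_add dE_scaleR dE_abs_le)

lemma energy_has_derivative:
  assumes V: "potential V" shows "(E V has_derivative dE V u) (at u)"
  unfolding has_derivative_at_alt
proof (intro conjI allI impI bounded_linear_dE V)
  fix \<epsilon> :: real assume \<epsilon>: "\<epsilon> > 0"
  obtain \<delta> where "\<delta> > 0" "\<And>v w. norm (v - u) \<le> \<delta> \<Longrightarrow> norm (w - u) \<le> \<delta> \<Longrightarrow>
    \<bar>E V w - E V v - dE V u (w - v)\<bar> \<le> \<epsilon> * norm (w - v)"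
    by (rule energy_strict_derivative[OF V \<epsilon>, of u]) blast
  then show "\<exists>d>0. \<forall>y. norm (y - u) < d \<longrightarrow> norm (E V y - E V u - dE V u (y - u)) \<le> \<epsilon> * norm (y - u)"
    by (intro exI[of _ \<delta>]) auto
qed

lemma energy_continuous: "potential V \<Longrightarrow> isCont (E V) u"
  by (rule has_derivative_continuous[OF energy_has_derivative])

lemma critical_point_iff:
  assumes V: "potential V" shows "critical_point (E V) u \<longleftrightarrow> (\<forall>h. dE V u h = 0)"
proof
  assume "critical_point (E V) u"
  then have "dE V u = (\<lambda>_. 0)"
    unfolding critical_point_def by (rule has_derivative_unique[OF energy_has_derivative[OF V]])
  then show "\<forall>h. dE V u h = 0" by simp
next
  assume "\<forall>h. dE V u h = 0"
  then have "dE V u = (\<lambda>_. 0)" by auto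
  then show "critical_point (E V) u"
    using energy_has_derivative[OF V, of u] by (simp add: critical_point_def)
qed

text \<open>Test the weak form with the indicator of a single vertex.\<close>

lemma critical_point_solves:
  fixes u :: "'n::finite h1"
  assumes V: "potential V" and c: "critical_point (E V) u"
  shows "solves_equation V f u"
  unfolding solves_equation_def
proof
  fix p :: "int ^ 'n"
  let ?d = "Abs_h1 (\<lambda>x. if x = p then 1 else 0 :: real)"
  let ?r = "\<lambda>x. - laplacian (h1_fun u) x + V x * h1_fun u x - f (h1_fun u x)"
  have "sqsum (\<lambda>x. if x = p then 1 else 0 :: real)"
    unfolding sqsum_def by (rule finite_nonzero_values_imp_summable_on) auto
  then have d: "h1_fun ?d = (\<lambda>x. if x = p then 1 else 0)" by (rule h1_fun_Abs)
  have "0 = dE V u ?d" using c critical_point_iff[OF V] by simp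
  also have "\<dots> = (\<Sum>\<^sub>\<infinity>x. ?r x * (if x = p then 1 else 0))"
    unfolding dE_weak_form[OF V] d ..
  also have "\<dots> = (\<Sum>\<^sub>\<infinity>x\<in>{p}. ?r x)"
    by (rule infsum_cong_neutral) auto
  finally show "- laplacian (h1_fun u) p + V p * h1_fun u p = f (h1_fun u p)" by simp
qed

section \<open>Peaks: maxima of the energy along rays\<close>

text \<open>These are the elements of the Nehari manifold, described by maximality along the ray instead of
  \<open>\<Phi>'(u) u = 0\<close>, so that no derivative is needed to produce or compare them.\<close>

definition peak :: "(int ^ 'n \<Rightarrow> real) \<Rightarrow> 'n::finite h1 \<Rightarrow> bool" where
  "peak V u \<longleftrightarrow> u \<noteq> 0 \<and> (\<forall>t\<ge>0. E V (t *\<^sub>R u) \<le> E V u)"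

text \<open>A fixed height below which the nonlinear part of the energy is dominated by half of the quadratic
  part.\<close>

definition \<eta> :: real where
  "\<eta> = (SOME \<eta>. \<eta> > 0 \<and> (\<forall>u. \<bar>u\<bar> \<le> \<eta> \<longrightarrow> F u \<le> \<alpha> / 4 * u\<^sup>2))"

lemma \<eta>: "\<eta> > 0" "\<bar>u\<bar> \<le> \<eta> \<Longrightarrow> F u \<le> \<alpha> / 4 * u\<^sup>2"
proof -
  have "\<alpha> / 4 > 0" using \<alpha> by simp
  then obtain e where "e > 0" "\<And>u. \<bar>u\<bar> \<le> e \<Longrightarrow> \<bar>F u\<bar> \<le> \<alpha> / 4 * u\<^sup>2"
    using f_small by metis
  then have "\<exists>\<eta>. \<eta> > 0 \<and> (\<forall>u. \<bar>u\<bar> \<le> \<eta> \<longrightarrow> F u \<le> \<alpha> / 4 * u\<^sup>2)"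
    by (meson abs_le_D1)
  from someI_ex[OF this] have "\<eta> > 0 \<and> (\<forall>u. \<bar>u\<bar> \<le> \<eta> \<longrightarrow> F u \<le> \<alpha> / 4 * u\<^sup>2)"
    unfolding \<eta>_def .
  then show "\<eta> > 0" "\<bar>u\<bar> \<le> \<eta> \<Longrightarrow> F u \<le> \<alpha> / 4 * u\<^sup>2" by blast+
qed

lemma F_sum_small:
  assumes "\<And>x. \<bar>h1_fun u x\<bar> \<le> \<eta>"
  shows "(\<Sum>\<^sub>\<infinity>x. F (h1_fun u x)) \<le> \<alpha> / 4 * (norm u)\<^sup>2"
proof -
  have "(\<Sum>\<^sub>\<infinity>x. F (h1_fun u x)) \<le> (\<Sum>\<^sub>\<infinity>x. \<alpha> / 4 * (h1_fun u x)\<^sup>2)"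
    using assms by (intro infsum_mono F_summable summable_on_cmult_right h1_square_summable \<eta>(2))
  also have "\<dots> = \<alpha> / 4 * (\<Sum>\<^sub>\<infinity>x. (h1_fun u x)\<^sup>2)"
    by (intro infsum_cmult_right h1_square_summable)
  also have "\<dots> \<le> \<alpha> / 4 * (norm u)\<^sup>2"
    using \<alpha> by (intro mult_left_mono h1_l2_le_norm) auto
  finally show ?thesis .
qed

lemma F_sum_nonneg: "0 \<le> (\<Sum>\<^sub>\<infinity>x. F (h1_fun u x))"
  by (intro infsum_nonneg F_nonneg)

lemma F_le_sum: "F (h1_fun u x) \<le> (\<Sum>\<^sub>\<infinity>x. F (h1_fun u x))"
  using finite_sum_le_infsum[OF F_summable, of "{x}" u] F_nonneg by simp

lemma form_le: "potential V \<Longrightarrow> form V u u \<le> (1 + \<beta>) * (norm u)\<^sup>2"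
  using form_abs_le[of V u u] by (simp add: power2_eq_square)

lemma energy_ray:
  assumes "potential V"
  shows "E V (t *\<^sub>R u) = t\<^sup>2 / 2 * form V u u - (\<Sum>\<^sub>\<infinity>x. F (t * h1_fun u x))"
  by (simp add: energy_eq assms form_scaleR_left form_scaleR_right power2_eq_square)

lemma energy_small_ge:
  assumes V: "potential V" and "\<And>x. \<bar>h1_fun u x\<bar> \<le> \<eta>"
  shows "\<alpha> / 4 * (norm u)\<^sup>2 \<le> E V u"
  using F_sum_small[OF assms(2)] form_ge[OF V, of u] by (simp add: energy_eq V)

text \<open>The peak is at least as high as the point of its ray with norm \<open>\<eta>\<close>.\<close>

lemma peak_energy_ge:
  assumes V: "potential V" and u: "peak V u"
  shows "\<alpha> / 4 * \<eta>\<^sup>2 \<le> E V u"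
proof -
  have u0: "u \<noteq> 0" using u by (simp add: peak_def)
  let ?v = "(\<eta> / norm u) *\<^sub>R u"
  have n: "norm ?v = \<eta>" using u0 \<eta>(1) by simp
  then have "\<alpha> / 4 * \<eta>\<^sup>2 \<le> E V ?v"
    using energy_small_ge[OF V, of ?v] h1_fun_le_norm[of ?v] by simp
  also have "\<dots> \<le> E V u" using u \<eta>(1) unfolding peak_def by simp
  finally show ?thesis .
qed

lemma peak_energy_pos: "potential V \<Longrightarrow> peak V u \<Longrightarrow> 0 < E V u"
  using peak_energy_ge[of V u] \<alpha> \<eta>(1) by (meson divide_pos_pos less_le_trans mult_pos_pos zero_less_numeral zero_less_power)

text \<open>If \<open>u\<close> were uniformly small, then \<open>2 u\<close> would still be in the range where the quadratic part
  dominates, and would have larger energy than \<open>u\<close>.\<close>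

lemma peak_nonvanishing:
  assumes V: "potential V" and u: "peak V u"
  obtains x where "\<bar>h1_fun u x\<bar> > \<eta> / 2"
proof (rule ccontr)
  assume "\<not> thesis"
  then have "\<bar>h1_fun (2 *\<^sub>R u) x\<bar> \<le> \<eta>" for x using that[of x] by fastforce
  then have "(\<Sum>\<^sub>\<infinity>x. F (h1_fun (2 *\<^sub>R u) x)) \<le> \<alpha> / 4 * (norm (2 *\<^sub>R u))\<^sup>2" by (rule F_sum_small)
  then have "2 * form V u u - \<alpha> * (norm u)\<^sup>2 \<le> E V (2 *\<^sub>R u)"
    using energy_ray[OF V, of 2 u] by (simp add: power_mult_distrib)
  also have "\<dots> \<le> E V u" using u unfolding peak_def by simp
  also have "\<dots> \<le> form V u u / 2" using F_sum_nonneg[of u] by (simp add: energy_eq V)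
  finally have "3 / 2 * form V u u \<le> \<alpha> * (norm u)\<^sup>2" by simp
  moreover have "\<alpha> * (norm u)\<^sup>2 > 0" using u \<alpha> by (simp add: peak_def)
  ultimately show False using form_ge[OF V, of u] by linarith
qed

text \<open>Normalise \<open>u\<close> to norm 1. If the result is uniformly small, then a large fixed multiple \<open>s\<close> of it
  still has energy above \<open>b\<close>, which contradicts maximality along the ray. Otherwise \<open>\<bar>u\<bar>\<close> is at
  some vertex at least a fixed fraction of its norm, and the superquadratic growth of \<open>F\<close> at this
  single vertex makes the energy negative as soon as the norm is large.\<close>

lemma peaks_bounded:
  obtains L where "\<And>V (u :: 'n::finite h1). potential V \<Longrightarrow> peak V u \<Longrightarrow> E V u \<le> b \<Longrightarrow> norm u \<le> L"
proof -
  \<comment> \<open>Chosen so that a uniformly small function of norm \<open>s\<close> has energy above \<open>b\<close>.\<close>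
  define s where "s = 1 + 4 * (\<bar>b\<bar> + 1) / \<alpha>"
  have s1: "s \<ge> 1" using \<alpha> by (simp add: s_def)
  have "\<alpha> / 4 * s = \<alpha> / 4 + \<bar>b\<bar> + 1" using \<alpha> by (simp add: s_def field_simps)
  then have "b < \<alpha> / 4 * s" using \<alpha> by linarith
  also have "\<dots> \<le> \<alpha> / 4 * s\<^sup>2" using s1 \<alpha> by (intro mult_left_mono self_le_power) auto
  finally have s2: "b < \<alpha> / 4 * s\<^sup>2" .
  define \<theta> where "\<theta> = \<eta> / s"
  have \<theta>: "\<theta> > 0" "s * \<theta> = \<eta>" using s1 \<eta>(1) by (auto simp: \<theta>_def)
  obtain R where R: "R > 0" "\<And>u. \<bar>u\<bar> \<ge> R \<Longrightarrow> F u \<ge> (1 + \<beta>) / \<theta>\<^sup>2 * u\<^sup>2"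
    using F_superquadratic by metis
  have "norm u \<le> R / \<theta>" if V: "potential V" and u: "peak V u" and b: "E V u \<le> b"
    for V and u :: "'n h1"
  proof (rule ccontr)
    assume "\<not> norm u \<le> R / \<theta>"
    then have large: "R < \<theta> * norm u" using \<theta> by (simp add: field_simps)
    have u0: "norm u > 0" using u by (simp add: peak_def)
    let ?v = "(s / norm u) *\<^sub>R u"
    have "E V ?v \<le> E V u" using u s1 u0 unfolding peak_def by simp
    moreover have "\<alpha> / 4 * s\<^sup>2 \<le> E V ?v" if "\<forall>x. \<bar>h1_fun ?v x\<bar> \<le> \<eta>"
      using energy_small_ge[OF V, of ?v] that u0 s1 by simp
    ultimately have "\<not> (\<forall>x. \<bar>h1_fun ?v x\<bar> \<le> \<eta>)" using b s2 by (meson not_le order_trans)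
    then obtain x where "\<bar>h1_fun ?v x\<bar> > \<eta>" by (meson not_le)
    then have "\<eta> * norm u < s * \<bar>h1_fun u x\<bar>"
      using u0 s1 by (simp add: abs_mult field_simps)
    then have "s * (\<theta> * norm u) < s * \<bar>h1_fun u x\<bar>"
      by (simp only: \<theta>(2)[symmetric] mult.assoc)
    then have x: "\<theta> * norm u < \<bar>h1_fun u x\<bar>" using s1 by simp
    have "(\<theta> * norm u)\<^sup>2 \<le> (h1_fun u x)\<^sup>2"
      using power_mono[of "\<theta> * norm u" "\<bar>h1_fun u x\<bar>" 2] x \<theta> by simp
    then have "(1 + \<beta>) / \<theta>\<^sup>2 * (\<theta> * norm u)\<^sup>2 \<le> (1 + \<beta>) / \<theta>\<^sup>2 * (h1_fun u x)\<^sup>2"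
      using \<beta> by (intro mult_left_mono) auto
    also have "\<dots> \<le> F (h1_fun u x)" using x large by (intro R(2)) simp
    also have "\<dots> \<le> (\<Sum>\<^sub>\<infinity>x. F (h1_fun u x))" by (rule F_le_sum)
    finally have "(1 + \<beta>) * (norm u)\<^sup>2 \<le> (\<Sum>\<^sub>\<infinity>x. F (h1_fun u x))"
      using \<theta> by (simp add: power_mult_distrib)
    moreover have "(1 + \<beta>) * (norm u)\<^sup>2 > 0" using u0 \<beta> by simp
    ultimately have "E V u < 0" using form_le[OF V, of u] by (simp add: energy_eq V)
    then show False using peak_energy_pos[OF V u] by simp
  qed
  then show ?thesis using that by blast
qed

lemma energy_ray_negative:
  assumes V: "potential V" and u: "u \<noteq> 0"
  obtains T where "T > 0" "E V (T *\<^sub>R u) < 0"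
proof -
  obtain x where x: "h1_fun u x \<noteq> 0"
    using u h1_eqI[of u 0] by auto
  let ?A = "(1 + \<beta>) * (norm u)\<^sup>2 / (h1_fun u x)\<^sup>2"
  obtain R where R: "R > 0" "\<And>s. \<bar>s\<bar> \<ge> R \<Longrightarrow> F s \<ge> ?A * s\<^sup>2"
    using F_superquadratic by metis
  define T where "T = R / \<bar>h1_fun u x\<bar>"
  have T: "T > 0" using R x by (simp add: T_def)
  have "?A * (T * h1_fun u x)\<^sup>2 \<le> F (T * h1_fun u x)"
    using x R(1) by (intro R(2)) (simp add: T_def abs_mult)
  also have "\<dots> \<le> (\<Sum>\<^sub>\<infinity>x. F (T * h1_fun u x))" using F_le_sum[of "T *\<^sub>R u" x] by simp
  finally have 1: "T\<^sup>2 * ((1 + \<beta>) * (norm u)\<^sup>2) \<le> (\<Sum>\<^sub>\<infinity>x. F (T * h1_fun u x))"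
    using x by (simp add: power_mult_distrib ac_simps)
  have "T\<^sup>2 * form V u u \<le> T\<^sup>2 * ((1 + \<beta>) * (norm u)\<^sup>2)"
    by (intro mult_left_mono form_le V) auto
  moreover have "T\<^sup>2 * ((1 + \<beta>) * (norm u)\<^sup>2) > 0" using T u \<beta> by simp
  ultimately have "E V (T *\<^sub>R u) < 0" using 1 energy_ray[OF V, of T u] by simp
  then show ?thesis using that T by blast
qed

text \<open>Hence \<open>E V (t u) / t\<^sup>2\<close> is nonincreasing in \<open>t\<close>: once negative, the energy stays negative along the
  ray.\<close>

lemma energy_ray_quadratic:
  assumes V: "potential V" and t: "t \<ge> 1"
  shows "E V (t *\<^sub>R u) \<le> t\<^sup>2 * E V u"
proof -
  have "t\<^sup>2 * (\<Sum>\<^sub>\<infinity>x. F (h1_fun u x)) = (\<Sum>\<^sub>\<infinity>x. t\<^sup>2 * F (h1_fun u x))"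
    by (intro infsum_cmult_right[symmetric] F_summable)
  also have "\<dots> \<le> (\<Sum>\<^sub>\<infinity>x. F (h1_fun (t *\<^sub>R u) x))"
    using t by (intro infsum_mono summable_on_cmult_right F_summable) (simp add: F_quadratic_growth)
  finally show ?thesis unfolding energy_ray[OF V] energy_eq[OF V, of u] by (simp add: algebra_simps)
qed

lemma energy_ray_compare:
  assumes V: "potential V" and s: "0 < s" "s \<le> t"
  shows "E V (t *\<^sub>R u) \<le> (t / s)\<^sup>2 * E V (s *\<^sub>R u)"
  using energy_ray_quadratic[OF V, of "t / s" "s *\<^sub>R u"] s by simp

lemma peak_exists:
  assumes V: "potential V" and neg: "T > 0" "E V (T *\<^sub>R u) < 0"
  obtains t where "0 < t" "t < T" "peak V (t *\<^sub>R u)"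
proof -
  have u0: "u \<noteq> 0" using neg by auto
  have cont: "continuous_on {0..T} (\<lambda>t. E V (t *\<^sub>R u))"
    by (intro continuous_at_imp_continuous_on ballI isCont_o2[OF _ energy_continuous[OF V]])
       (intro continuous_intros)
  obtain t where t: "t \<in> {0..T}" and max: "\<And>s. s \<in> {0..T} \<Longrightarrow> E V (s *\<^sub>R u) \<le> E V (t *\<^sub>R u)"
    using continuous_attains_sup[OF _ _ cont] neg(1) by fastforce
  define s where "s = min T (\<eta> / norm u)"
  have s: "0 < s" "s \<le> T" "s * norm u \<le> \<eta>"
    using neg(1) \<eta>(1) u0 by (auto simp: s_def min_def field_simps)
  have "\<bar>h1_fun (s *\<^sub>R u) x\<bar> \<le> \<eta>" for x
    using h1_fun_le_norm[of "s *\<^sub>R u" x] s by simp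
  then have "\<alpha> / 4 * (norm (s *\<^sub>R u))\<^sup>2 \<le> E V (s *\<^sub>R u)" by (rule energy_small_ge[OF V])
  moreover have "\<alpha> / 4 * (norm (s *\<^sub>R u))\<^sup>2 > 0" using s u0 \<alpha> by simp
  ultimately have pos: "E V (t *\<^sub>R u) > 0" using max[of s] s by simp
  then have "t \<noteq> 0" "t \<noteq> T" using neg by auto
  then have t': "0 < t" "t < T" using t by auto
  have all: "E V (r *\<^sub>R u) \<le> E V (t *\<^sub>R u)" if "r \<ge> 0" for r
  proof (cases "r \<le> T")
    case False
    then have "E V (r *\<^sub>R u) \<le> (r / T)\<^sup>2 * E V (T *\<^sub>R u)"
      using neg(1) by (intro energy_ray_compare V) auto
    also have "\<dots> \<le> 0" using neg by (intro mult_nonneg_nonpos) auto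
    finally show ?thesis using pos by simp
  qed (use max that in auto)
  have "peak V (t *\<^sub>R u)"
    unfolding peak_def using all t' u0 by auto
  then show ?thesis using that t' by blast
qed

text \<open>Sum the strict tangent inequality for \<open>F\<close>; the linear terms cancel since \<open>dE V u u = 0\<close>.\<close>

lemma critical_along_ray_imp_strict_peak:
  assumes V: "potential V" and u: "u \<noteq> 0" "dE V u u = 0" and t: "t \<ge> 0" "t \<noteq> 1"
  shows "E V (t *\<^sub>R u) < E V u"
proof -
  let ?c = "(t\<^sup>2 - 1) / 2"
  let ?g = "\<lambda>x. F (t * h1_fun u x) + (- F (h1_fun u x) + - (?c * (f (h1_fun u x) * h1_fun u x)))"
  have s1: "(\<lambda>x. F (t * h1_fun u x)) summable_on UNIV" using F_summable[of "t *\<^sub>R u"] by simp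
  have s2: "(\<lambda>x. - F (h1_fun u x)) summable_on UNIV" by (simp only: summable_on_uminus F_summable)
  have s3: "(\<lambda>x. ?c * (f (h1_fun u x) * h1_fun u x)) summable_on UNIV"
    by (intro summable_on_cmult_right f_prod_summable)
  have s3': "(\<lambda>x. - (?c * (f (h1_fun u x) * h1_fun u x))) summable_on UNIV"
    using s3 by (simp only: summable_on_uminus)
  obtain x where x: "h1_fun u x \<noteq> 0" using u h1_eqI[of u 0] by auto
  have "0 < ?g x" using F_ray_strict[OF x t] by simp
  also have "?g x \<le> infsum ?g UNIV"
  proof -
    have "?g summable_on UNIV" by (intro summable_on_add s1 s2 s3')
    moreover have "0 \<le> ?g y" for y using F_ray_le[OF t(1), of "h1_fun u y"] by simp
    ultimately have "sum ?g {x} \<le> infsum ?g UNIV" by (intro finite_sum_le_infsum) auto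
    then show ?thesis by simp
  qed
  also have "\<dots> = (\<Sum>\<^sub>\<infinity>x. F (t * h1_fun u x)) + (- (\<Sum>\<^sub>\<infinity>x. F (h1_fun u x))
      + - (?c * (\<Sum>\<^sub>\<infinity>x. f (h1_fun u x) * h1_fun u x)))"
    by (simp only: infsum_add s1 s2 s3' summable_on_add infsum_uminus infsum_cmult_right f_prod_summable)
  also have "(\<Sum>\<^sub>\<infinity>x. f (h1_fun u x) * h1_fun u x) = form V u u" using u(2) by (simp add: dE_def)
  finally show ?thesis
    unfolding energy_ray[OF V] energy_eq[OF V, of u] by (simp add: field_simps)
qed

lemma critical_positive_imp_peak:
  assumes V: "potential V" and u: "critical_point (E V) u" "E V u > 0"
  shows "peak V u"
proof -
  have "u \<noteq> 0" using u(2) by auto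
  moreover have "dE V u u = 0" using u(1) critical_point_iff[OF V] by blast
  ultimately have "E V (t *\<^sub>R u) \<le> E V u" if "t \<ge> 0" for t
    using critical_along_ray_imp_strict_peak[OF V, of u t] that by (cases "t = 1") auto
  then show ?thesis using \<open>u \<noteq> 0\<close> by (simp add: peak_def)
qed

lemma peak_imp_critical_along_ray:
  assumes V: "potential V" and u: "peak V u"
  shows "dE V u u = 0"
proof -
  have "((\<lambda>t. E V (t *\<^sub>R u)) has_derivative (\<lambda>s. dE V (1 *\<^sub>R u) (s *\<^sub>R u))) (at 1)"
    by (rule has_derivative_compose[OF _ energy_has_derivative[OF V]])
       (auto intro!: derivative_eq_intros)
  then have "DERIV (\<lambda>t. E V (t *\<^sub>R u)) 1 :> dE V u u"
    by (simp add: has_field_derivative_def dE_scaleR V mult_commute_abs)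
  then show ?thesis
    by (rule DERIV_local_max[where d = 1]) (use u in \<open>auto simp: peak_def\<close>)
qed

text \<open>If the derivative in direction \<open>h\<close> were negative, consider the rays through \<open>u + e h\<close> for small
  \<open>e > 0\<close>. Their peaks \<open>t (u + e h)\<close> have \<open>t\<close> near 1, since the ray through \<open>u\<close> has its strict maximum
  at \<open>u\<close>. By minimality \<open>E V (t (u + e h)) \<ge> E V u \<ge> E V (t u)\<close>, whereas strict differentiability
  at \<open>u\<close> makes the difference of the outer terms negative. This replaces the differentiable
  structure of the Nehari manifold, which is missing when \<open>f\<close> is merely continuous.\<close>

lemma minimal_peak_critical:
  fixes u :: "'n::finite h1"
  assumes V: "potential V" and u: "peak V u" and min: "\<And>v. peak V v \<Longrightarrow> E V u \<le> E V v"
  shows "critical_point (E V) u"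
proof -
  have "0 \<le> dE V u h" for h
  proof (rule ccontr)
    assume neg: "\<not> ?thesis"
    define \<epsilon> where "\<epsilon> = - dE V u h / (2 * (norm h + 1))"
    have n1: "norm h + 1 > 0" by (simp add: add_nonneg_pos)
    have \<epsilon>: "\<epsilon> > 0" unfolding \<epsilon>_def using neg n1 by (intro divide_pos_pos) auto
    have \<epsilon>h: "\<epsilon> * norm h < - dE V u h"
    proof -
      have "\<epsilon> * norm h \<le> \<epsilon> * (norm h + 1)" using \<epsilon> by simp
      also have "\<dots> = - dE V u h / 2" using n1 by (simp add: \<epsilon>_def field_simps)
      finally show ?thesis using neg by simp
    qed
    obtain \<delta> where \<delta>: "\<delta> > 0" "\<And>v w. norm (v - u) \<le> \<delta> \<Longrightarrow> norm (w - u) \<le> \<delta> \<Longrightarrow>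
      \<bar>E V w - E V v - dE V u (w - v)\<bar> \<le> \<epsilon> * norm (w - v)"
      by (rule energy_strict_derivative[OF V \<epsilon>, of u]) blast
    have u0: "u \<noteq> 0" using u by (simp add: peak_def)
    obtain T where T: "T > 0" "E V (T *\<^sub>R u) < 0" by (rule energy_ray_negative[OF V u0])
    define e where "e n = inverse (real (Suc n))" for n
    have e0: "e n > 0" for n by (simp add: e_def)
    have e_lim: "e \<longlonglongrightarrow> 0" unfolding e_def by (rule LIMSEQ_inverse_real_of_nat)
    define U where "U n = u + e n *\<^sub>R h" for n
    have "U \<longlonglongrightarrow> u + 0 *\<^sub>R h" unfolding U_def by (intro tendsto_intros e_lim)
    then have U: "U \<longlonglongrightarrow> u" by simp
    have "(\<lambda>n. E V (T *\<^sub>R U n)) \<longlonglongrightarrow> E V (T *\<^sub>R u)"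
      by (intro isCont_tendsto_compose[OF energy_continuous[OF V]] tendsto_intros U)
    then have "eventually (\<lambda>n. E V (T *\<^sub>R U n) < 0) sequentially"
      using T(2) by (rule order_tendstoD(2))
    then obtain N where N: "\<And>n. n \<ge> N \<Longrightarrow> E V (T *\<^sub>R U n) < 0"
      by (auto simp: eventually_sequentially)
    have "\<exists>t. 0 < t \<and> t < T \<and> peak V (t *\<^sub>R U (n + N))" for n
      by (rule peak_exists[OF V T(1) N[of "n + N"]]) auto
    then obtain t where t: "\<And>n. 0 < t n" "\<And>n. t n < T" "\<And>n. peak V (t n *\<^sub>R U (n + N))" by metis
    have "\<forall>n. t n \<in> {0..T}" using t by (simp add: less_imp_le)
    then obtain l r where r: "strict_mono (r :: nat \<Rightarrow> nat)" "(t \<circ> r) \<longlonglongrightarrow> l" "l \<in> {0..T}"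
      using compact_Icc[of 0 T] unfolding compact_eq_seq_compact_metric seq_compact_def by metis
    have rN: "strict_mono (\<lambda>n. r n + N)" using r(1) by (simp add: strict_mono_def)
    let ?s = "\<lambda>n. t (r n)" and ?W = "\<lambda>n. U (r n + N)"
    have s: "?s \<longlonglongrightarrow> l" using r(2) by (simp add: o_def)
    have W: "?W \<longlonglongrightarrow> u" using LIMSEQ_subseq_LIMSEQ[OF U rN] by (simp add: o_def)
    have "E V u \<le> E V (l *\<^sub>R u)"
    proof (rule LIMSEQ_le)
      show "(\<lambda>n. E V (?W n)) \<longlonglongrightarrow> E V u"
        by (intro isCont_tendsto_compose[OF energy_continuous[OF V]] W)
      show "(\<lambda>n. E V (?s n *\<^sub>R ?W n)) \<longlonglongrightarrow> E V (l *\<^sub>R u)"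
        by (intro isCont_tendsto_compose[OF energy_continuous[OF V]] tendsto_intros s W)
      have "E V (?W n) \<le> E V (?s n *\<^sub>R ?W n)" for n
        using t(3)[of "r n"] t(1)[of "r n"] unfolding peak_def
        by (auto dest!: spec[of _ "inverse (?s n)"])
      then show "\<exists>N. \<forall>n\<ge>N. E V (?W n) \<le> E V (?s n *\<^sub>R ?W n)" by blast
    qed
    \<comment> \<open>The limit \<open>l\<close> of the scales of the peaks near \<open>u\<close> is 1, by uniqueness of the maximum along the ray of \<open>u\<close>.\<close>
    then have l: "l = 1"
      using critical_along_ray_imp_strict_peak[OF V u0 peak_imp_critical_along_ray[OF V u], of l] r(3)
      by fastforce
    have "(\<lambda>n. ?s n *\<^sub>R ?W n) \<longlonglongrightarrow> l *\<^sub>R u" "(\<lambda>n. ?s n *\<^sub>R u) \<longlonglongrightarrow> l *\<^sub>R u"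
      by (intro tendsto_intros s W)+
    then have "eventually (\<lambda>n. dist (?s n *\<^sub>R ?W n) u < \<delta>) sequentially"
      "eventually (\<lambda>n. dist (?s n *\<^sub>R u) u < \<delta>) sequentially"
      using \<delta>(1) l by (auto dest: tendstoD)
    then have "eventually (\<lambda>n. dist (?s n *\<^sub>R ?W n) u < \<delta> \<and> dist (?s n *\<^sub>R u) u < \<delta>) sequentially"
      by (rule eventually_conj)
    then obtain n where n: "dist (?s n *\<^sub>R ?W n) u < \<delta>" "dist (?s n *\<^sub>R u) u < \<delta>"
      by (auto simp: eventually_sequentially)
    define k where "k = ?s n * e (r n + N)"
    have k: "k > 0" using t(1) e0 by (simp add: k_def)
    have diff: "?s n *\<^sub>R ?W n - ?s n *\<^sub>R u = k *\<^sub>R h"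
      by (simp add: U_def k_def scaleR_right_distrib)
    have "\<bar>E V (?s n *\<^sub>R ?W n) - E V (?s n *\<^sub>R u) - dE V u (k *\<^sub>R h)\<bar> \<le> \<epsilon> * norm (k *\<^sub>R h)"
      using \<delta>(2)[of "?s n *\<^sub>R u" "?s n *\<^sub>R ?W n"] n unfolding diff by (simp add: dist_norm)
    moreover have "E V (?s n *\<^sub>R u) \<le> E V u" using u t(1)[of "r n"] by (simp add: peak_def)
    moreover have "E V u \<le> E V (?s n *\<^sub>R ?W n)" by (rule min[OF t(3)])
    ultimately have "- (k * dE V u h) \<le> \<epsilon> * (k * norm h)"
      using k by (simp add: dE_scaleR V abs_le_iff)
    then have "k * (- dE V u h) \<le> k * (\<epsilon> * norm h)" by (simp add: algebra_simps)
    then have "- dE V u h \<le> \<epsilon> * norm h" using k by (rule mult_left_le_imp_le)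
    then show False using \<epsilon>h by simp
  qed
  note nonneg = this
  have "dE V u h = 0" for h
    using nonneg[of h] nonneg[of "(-1) *\<^sub>R h"] by (simp only: dE_scaleR V)
  then show ?thesis by (simp add: critical_point_iff V)
qed

section \<open>Concentration compactness for minimising sequences of peaks\<close>

lemma energy_mono:
  assumes "potential V" "potential W" "\<And>x. V x \<le> W x"
  shows "E V u \<le> E W u"
proof -
  have "(\<Sum>\<^sub>\<infinity>x. (V x - 1) * h1_fun u x * h1_fun u x) \<le> (\<Sum>\<^sub>\<infinity>x. (W x - 1) * h1_fun u x * h1_fun u x)"
    using assms by (intro infsum_mono potential_summable) (auto simp: mult.assoc intro!: mult_right_mono)
  then show ?thesis by (simp add: energy_eq assms form_def)
qed

lemma energy_translate:
  "E (\<lambda>y. V (y + k)) (translate_h1 k u) = E V u"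
proof -
  let ?g = "\<lambda>x. (1/2) * (\<Sum>y\<in>nbrs x. (h1_fun u y - h1_fun u x)\<^sup>2) + V x * (h1_fun u x)\<^sup>2"
  show ?thesis
    unfolding energy_def
    using infsum_translate[of ?g k] infsum_translate[of "\<lambda>x. F (h1_fun u x)" k]
    by (simp add: sum_nbrs_translate[of "\<lambda>y x. (h1_fun u y - h1_fun u x)\<^sup>2"])
qed

lemma translate_eq_0_iff: "translate_h1 k u = 0 \<longleftrightarrow> u = 0"
  by (metis norm_eq_zero norm_translate)

lemma peak_translate: "peak (\<lambda>y. V (y + k)) (translate_h1 k u) \<longleftrightarrow> peak V u"
  by (simp add: peak_def translate_eq_0_iff energy_translate flip: translate_scaleR)

lemma potential_translate: "potential V \<Longrightarrow> potential (\<lambda>y. V (y + k))"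
  by (simp add: potential_def)

lemma potential_limit:
  fixes W :: "int ^ 'n::finite \<Rightarrow> real"
  assumes "\<And>n. potential (V n)" "\<And>x. (\<lambda>n. V n x) \<longlonglongrightarrow> W x"
  shows "potential W"
  unfolding potential_def
proof (intro allI conjI)
  fix x
  show "\<alpha> \<le> W x" using assms(1) by (intro LIMSEQ_le_const[OF assms(2)]) (auto simp: potential_def)
  show "W x \<le> \<beta>" using assms(1) by (intro LIMSEQ_le_const2[OF assms(2)]) (auto simp: potential_def)
qed

text \<open>The quadratic part contributes the cross term of the form, the nonlinear part the defect of
  additivity of \<open>F\<close>.\<close>

lemma energy_splitting_bound:
  assumes V: "potential V" and s: "0 \<le> s" "s \<le> T" and z: "norm z \<le> Z" and w: "norm w \<le> Z"
  shows "\<bar>E V (s *\<^sub>R (w + z)) - E V (s *\<^sub>R w) - E V (s *\<^sub>R z)\<bar>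
    \<le> T\<^sup>2 * (\<bar>inner w z\<bar> + (\<beta> + 8 * lin_bound (6 * (T * Z))) * (\<Sum>\<^sub>\<infinity>x. \<bar>h1_fun w x * h1_fun z x\<bar>))"
proof -
  let ?w = "h1_fun w" and ?z = "h1_fun z" and ?L = "8 * lin_bound (6 * (T * Z))"
  let ?S = "\<Sum>\<^sub>\<infinity>x. \<bar>?w x * ?z x\<bar>"
  have L: "?L \<ge> 0" using lin_bound_nonneg by simp
  have S: "?S \<ge> 0" by (intro infsum_nonneg) auto
  let ?D = "\<lambda>x. F (h1_fun (s *\<^sub>R (w + z)) x) + (- F (h1_fun (s *\<^sub>R w) x) + - F (h1_fun (s *\<^sub>R z) x))"
  have sF: "(\<lambda>x. - F (h1_fun v x)) summable_on UNIV" for v :: "'a h1"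
    by (simp only: summable_on_uminus F_summable)
  have D: "infsum ?D UNIV = (\<Sum>\<^sub>\<infinity>x. F (h1_fun (s *\<^sub>R (w + z)) x))
      - (\<Sum>\<^sub>\<infinity>x. F (h1_fun (s *\<^sub>R w) x)) - (\<Sum>\<^sub>\<infinity>x. F (h1_fun (s *\<^sub>R z) x))"
    by (simp only: infsum_add sF F_summable summable_on_add infsum_uminus)
  have small: "\<bar>s * h1_fun v x\<bar> \<le> T * Z" if "norm v \<le> Z" for v :: "'a h1" and x
    using mult_mono[of s T "\<bar>h1_fun v x\<bar>" Z] s h1_fun_le_norm[of v x] that by (simp add: abs_mult)
  have "\<bar>?D x\<bar> \<le> ?L * s\<^sup>2 * \<bar>?w x * ?z x\<bar>" for x
    using F_almost_additive[OF small[OF w, of x] small[OF z, of x]] s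
    by (simp add: abs_mult power2_eq_square distrib_left ac_simps)
  then have "\<bar>infsum ?D UNIV\<bar> \<le> (\<Sum>\<^sub>\<infinity>x. ?L * s\<^sup>2 * \<bar>?w x * ?z x\<bar>)"
    by (intro infsum_dominated(2) summable_on_cmult_right h1_abs_prod_summable)
  also have "\<dots> = ?L * s\<^sup>2 * ?S" by (intro infsum_cmult_right h1_abs_prod_summable)
  finally have 1: "\<bar>infsum ?D UNIV\<bar> \<le> ?L * s\<^sup>2 * ?S" .
  have "\<bar>\<Sum>\<^sub>\<infinity>x. (V x - 1) * ?w x * ?z x\<bar> \<le> (\<Sum>\<^sub>\<infinity>x. \<beta> * \<bar>?w x * ?z x\<bar>)"
    using potential_bounded[OF V]
    by (intro infsum_dominated(2) summable_on_cmult_right h1_abs_prod_summable)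
       (auto simp: abs_mult mult.assoc intro!: mult_right_mono)
  also have "\<dots> = \<beta> * ?S" by (intro infsum_cmult_right h1_abs_prod_summable)
  finally have 2: "\<bar>form V w z\<bar> \<le> \<bar>inner w z\<bar> + \<beta> * ?S" by (simp add: form_def)
  have "E V (s *\<^sub>R (w + z)) - E V (s *\<^sub>R w) - E V (s *\<^sub>R z) = s\<^sup>2 * form V w z - infsum ?D UNIV"
    unfolding D energy_eq[OF V] using form_commute[of V z w]
    by (simp add: form_add_left[OF V] form_add_right[OF V] form_scaleR_left[OF V] form_scaleR_right[OF V]
        power2_eq_square scaleR_right_distrib field_simps)
  then have "\<bar>E V (s *\<^sub>R (w + z)) - E V (s *\<^sub>R w) - E V (s *\<^sub>R z)\<bar>
      \<le> \<bar>s\<^sup>2 * form V w z\<bar> + \<bar>infsum ?D UNIV\<bar>" by linarith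
  also have "\<dots> \<le> s\<^sup>2 * (\<bar>inner w z\<bar> + \<beta> * ?S) + ?L * s\<^sup>2 * ?S"
    using 1 mult_left_mono[OF 2, of "s\<^sup>2"] by (simp add: abs_mult)
  also have "\<dots> = s\<^sup>2 * (\<bar>inner w z\<bar> + (\<beta> + ?L) * ?S)" by (simp add: algebra_simps)
  also have "\<dots> \<le> T\<^sup>2 * (\<bar>inner w z\<bar> + (\<beta> + ?L) * ?S)"
    using s S L \<beta> by (intro mult_right_mono power_mono) auto
  finally show ?thesis .
qed

text \<open>The energies differ by \<open>s\<^sup>2 / 2\<close> times the sum of \<open>(V n - W) w\<^sup>2\<close>, which is the pairing of \<open>w\<close> with
  the weakly null sequence \<open>(V n - W) w\<close>.\<close>

lemma energy_potential_convergence: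
  fixes w :: "'n::finite h1"
  assumes V: "\<And>n. potential (V n)" "\<And>x. (\<lambda>n. V n x) \<longlonglongrightarrow> W x"
    and s: "\<And>n. 0 \<le> s n" "\<And>n. s n \<le> T"
  shows "(\<lambda>n. E (V n) (s n *\<^sub>R w) - E W (s n *\<^sub>R w)) \<longlonglongrightarrow> 0"
proof -
  have W: "potential W" by (rule potential_limit[OF V])
  have VW: "\<bar>V n x - W x\<bar> \<le> \<beta>" for n x
    using V(1)[of n] W \<alpha> unfolding potential_def by (smt (verit))
  define z where "z n = Abs_h1 (\<lambda>x. (V n x - W x) * h1_fun w x)" for n
  have le: "((V n x - W x) * h1_fun w x)\<^sup>2 \<le> \<beta>\<^sup>2 * (h1_fun w x)\<^sup>2" for n x
    using power_mono[OF VW[of n x], of 2] by (simp add: power_mult_distrib mult_right_mono)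
  have sq: "sqsum (\<lambda>x. (V n x - W x) * h1_fun w x)" for n
    unfolding sqsum_def
    by (rule infsum_dominated(1)[OF summable_on_cmult_right[OF h1_square_summable[of w], of "\<beta>\<^sup>2"]])
       (use le in auto)
  have zf: "h1_fun (z n) x = (V n x - W x) * h1_fun w x" for n x
    by (simp add: z_def h1_fun_Abs[OF sq])
  let ?C = "(1 + 2 * real (card (nbrs (0 :: int ^ 'n)))) * (\<beta>\<^sup>2 * (norm w)\<^sup>2)"
  have "(norm (z n))\<^sup>2 \<le> ?C" for n
  proof -
    have "(\<Sum>\<^sub>\<infinity>x. (h1_fun (z n) x)\<^sup>2) \<le> (\<Sum>\<^sub>\<infinity>x. \<beta>\<^sup>2 * (h1_fun w x)\<^sup>2)"
      by (intro infsum_mono h1_square_summable summable_on_cmult_right) (simp add: zf le)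
    also have "\<dots> = \<beta>\<^sup>2 * (\<Sum>\<^sub>\<infinity>x. (h1_fun w x)\<^sup>2)" by (intro infsum_cmult_right h1_square_summable)
    also have "\<dots> \<le> \<beta>\<^sup>2 * (norm w)\<^sup>2" by (intro mult_left_mono h1_l2_le_norm) auto
    finally show ?thesis
      using h1_norm_le_l2[of "z n"] by (meson mult_left_mono order_trans add_nonneg_nonneg zero_le_one of_nat_0_le_iff mult_nonneg_nonneg zero_le_numeral)
  qed
  then have zn: "norm (z n) \<le> sqrt ?C" for n by (rule real_le_rsqrt)
  have "(\<lambda>n. h1_fun (z n) x) \<longlonglongrightarrow> (W x - W x) * h1_fun w x" for x
    unfolding zf by (intro tendsto_intros V)
  then have lim: "(\<lambda>n. \<Sum>\<^sub>\<infinity>x. \<bar>h1_fun w x * h1_fun (z n) x\<bar>) \<longlonglongrightarrow> 0"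
    by (intro h1_weak_null[OF zn]) simp
  have "norm (E (V n) (s n *\<^sub>R w) - E W (s n *\<^sub>R w)) \<le> T\<^sup>2 * (\<Sum>\<^sub>\<infinity>x. \<bar>h1_fun w x * h1_fun (z n) x\<bar>)" for n
  proof -
    have "form (V n) w w - form W w w
        = (\<Sum>\<^sub>\<infinity>x. (V n x - 1) * h1_fun w x * h1_fun w x + - ((W x - 1) * h1_fun w x * h1_fun w x))"
      using infsum_add[OF potential_summable[OF V(1)[of n], of w w], of "\<lambda>x. - ((W x - 1) * h1_fun w x * h1_fun w x)"]
        potential_summable[OF W, of w w]
      by (simp only: summable_on_uminus infsum_uminus form_def)
    also have "\<dots> = (\<Sum>\<^sub>\<infinity>x. h1_fun w x * h1_fun (z n) x)"
      by (simp add: zf algebra_simps)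
    finally have "\<bar>form (V n) w w - form W w w\<bar> \<le> (\<Sum>\<^sub>\<infinity>x. \<bar>h1_fun w x * h1_fun (z n) x\<bar>)"
      using infsum_dominated(2)[OF h1_abs_prod_summable[of w "z n"], of "\<lambda>x. h1_fun w x * h1_fun (z n) x"]
      by simp
    moreover have "E (V n) (s n *\<^sub>R w) - E W (s n *\<^sub>R w) = (s n)\<^sup>2 / 2 * (form (V n) w w - form W w w)"
      by (simp add: energy_ray[OF V(1)] energy_ray[OF W] field_simps)
    moreover have "(s n)\<^sup>2 / 2 \<le> T\<^sup>2"
      using power_mono[OF s(2) s(1), of n 2] zero_le_power2[of T] by linarith
    ultimately show ?thesis by (simp only: real_norm_def abs_mult) (intro mult_mono, auto)
  qed
  moreover have "(\<lambda>n. T\<^sup>2 * (\<Sum>\<^sub>\<infinity>x. \<bar>h1_fun w x * h1_fun (z n) x\<bar>)) \<longlonglongrightarrow> 0"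
    using tendsto_mult_left[OF lim, of "T\<^sup>2"] by simp
  ultimately show ?thesis by (rule Lim_null_comparison[OF always_eventually[OF allI]])
qed

text \<open>A Brezis--Lieb splitting, uniform for bounded scalings \<open>s\<close>: the energy of \<open>w n\<close> is asymptotically
  the energy of the limit with respect to the limit potential plus the energy of the remainder.\<close>

lemma energy_splitting:
  fixes w :: "nat \<Rightarrow> 'n::finite h1"
  assumes V: "\<And>n. potential (V n)" "\<And>x. (\<lambda>n. V n x) \<longlonglongrightarrow> W x"
    and w: "\<And>n. norm (w n) \<le> L" "\<And>x. (\<lambda>n. h1_fun (w n) x) \<longlonglongrightarrow> h1_fun w' x"
    and s: "\<And>n. 0 \<le> s n" "\<And>n. s n \<le> T"
  shows "(\<lambda>n. E (V n) (s n *\<^sub>R w n) - E W (s n *\<^sub>R w') - E (V n) (s n *\<^sub>R (w n - w'))) \<longlonglongrightarrow> 0"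
proof -
  define z where "z n = w n - w'" for n
  define Z where "Z = L + norm w'"
  have L: "0 \<le> L" using w(1)[of 0] norm_ge_zero order_trans by blast
  have z: "norm (z n) \<le> Z" for n
    using norm_triangle_ineq4[of "w n" w'] w(1)[of n] by (simp add: z_def Z_def)
  have w': "norm w' \<le> Z" using L by (simp add: Z_def)
  have z0: "(\<lambda>n. h1_fun (z n) x) \<longlonglongrightarrow> 0" for x
    using tendsto_diff[OF w(2)[of x] tendsto_const[of "h1_fun w' x"]] by (simp add: z_def)
  let ?K = "\<beta> + 8 * lin_bound (6 * (T * Z))"
  let ?S = "\<lambda>n. \<Sum>\<^sub>\<infinity>x. \<bar>h1_fun w' x * h1_fun (z n) x\<bar>"
  have S: "?S \<longlonglongrightarrow> 0" by (rule h1_weak_null[OF z z0])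
  have I: "(\<lambda>n. \<bar>inner w' (z n)\<bar>) \<longlonglongrightarrow> 0"
  proof -
    \<comment> \<open>The Riesz representative of \<open>inner w'\<close> with respect to the \<open>\<ell>\<^sup>2\<close> pairing.\<close>
    define g where "g = Abs_h1 (\<lambda>x. h1_fun w' x - laplacian (h1_fun w') x)"
    have g: "h1_fun g = (\<lambda>x. h1_fun w' x - laplacian (h1_fun w') x)"
      unfolding g_def by (intro h1_fun_Abs sqsum_diff sqsum_laplacian sqsum_h1)
    have "(\<lambda>n. \<Sum>\<^sub>\<infinity>x. \<bar>h1_fun g x * h1_fun (z n) x\<bar>) \<longlonglongrightarrow> 0" by (rule h1_weak_null[OF z z0])
    moreover have "norm \<bar>inner w' (z n)\<bar> \<le> (\<Sum>\<^sub>\<infinity>x. \<bar>h1_fun g x * h1_fun (z n) x\<bar>)" for n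
      unfolding real_norm_def abs_idempotent Green_identity[of w'] fun_cong[OF g, symmetric]
      by (intro infsum_dominated(2) h1_abs_prod_summable) simp
    ultimately show ?thesis
      by (rule Lim_null_comparison[OF always_eventually[OF allI], rotated])
  qed
  have "(\<lambda>n. T\<^sup>2 * (\<bar>inner w' (z n)\<bar> + ?K * ?S n)) \<longlonglongrightarrow> T\<^sup>2 * (0 + ?K * 0)"
    by (intro tendsto_intros S I)
  then have "(\<lambda>n. T\<^sup>2 * (\<bar>inner w' (z n)\<bar> + ?K * ?S n)) \<longlonglongrightarrow> 0" by simp
  moreover have "norm (E (V n) (s n *\<^sub>R (w' + z n)) - E (V n) (s n *\<^sub>R w') - E (V n) (s n *\<^sub>R z n))
      \<le> T\<^sup>2 * (\<bar>inner w' (z n)\<bar> + ?K * ?S n)" for n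
    unfolding real_norm_def by (rule energy_splitting_bound[OF V(1) s z w'])
  ultimately have split: "(\<lambda>n. E (V n) (s n *\<^sub>R (w' + z n)) - E (V n) (s n *\<^sub>R w') - E (V n) (s n *\<^sub>R z n)) \<longlonglongrightarrow> 0"
    by (rule Lim_null_comparison[OF always_eventually[OF allI], rotated])
  let ?a = "\<lambda>n. E (V n) (s n *\<^sub>R (w' + z n))" and ?b = "\<lambda>n. E (V n) (s n *\<^sub>R w')"
    and ?c = "\<lambda>n. E (V n) (s n *\<^sub>R z n)" and ?d = "\<lambda>n. E W (s n *\<^sub>R w')"
  from tendsto_add[OF split energy_potential_convergence[where s = s and w = w', OF V s]]
  have "(\<lambda>n. ?a n - ?b n - ?c n + (?b n - ?d n)) \<longlonglongrightarrow> 0" by (simp only: add_0_left)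
  moreover have "(\<lambda>n. ?a n - ?b n - ?c n + (?b n - ?d n)) = (\<lambda>n. ?a n - ?d n - ?c n)"
    by (rule ext) simp
  ultimately have "(\<lambda>n. ?a n - ?d n - ?c n) \<longlonglongrightarrow> 0" by (simp only:)
  then show ?thesis by (simp add: z_def)
qed

text \<open>Let \<open>t w'\<close> be a peak of the limit potential and suppose that its energy exceeds \<open>c\<close>. Since \<open>w n\<close> is
  a peak of asymptotic height \<open>c\<close>, splitting at scale \<open>t\<close> forces \<open>E (V n) (t z) < 0\<close> for the remainder
  \<open>z = w n - w'\<close>. So the ray through \<open>z\<close> has its peak at some scale \<open>s < t\<close>, of height at least \<open>c\<close>.
  Splitting at scale \<open>s\<close> then leaves at most \<open>o(1)\<close> for \<open>E W (s w')\<close>. But \<open>s\<close> is bounded below, because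
  peaks do not vanish uniformly and \<open>z\<close> is bounded, and \<open>E W\<close> is bounded below by a positive number
  on the corresponding segment of the ray through \<open>w'\<close>.\<close>

lemma minimising_limit:
  fixes w :: "nat \<Rightarrow> 'n::finite h1"
  assumes V: "\<And>n. potential (V n)" "\<And>x. (\<lambda>n. V n x) \<longlonglongrightarrow> W x"
    and c: "\<And>n v. peak (V n) v \<Longrightarrow> c \<le> E (V n) v"
    and w: "\<And>n. peak (V n) (w n)" "(\<lambda>n. E (V n) (w n)) \<longlonglongrightarrow> c"
    and L: "\<And>n. norm (w n) \<le> L"
    and lim: "\<And>x. (\<lambda>n. h1_fun (w n) x) \<longlonglongrightarrow> h1_fun w' x" and w': "w' \<noteq> 0"
  obtains v where "peak W v" "E W v \<le> c"
proof -
  have W: "potential W" by (rule potential_limit[OF V])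
  obtain T where T: "T > 0" "E W (T *\<^sub>R w') < 0" by (rule energy_ray_negative[OF W w'])
  obtain t where t: "t > 0" "peak W (t *\<^sub>R w')" by (rule peak_exists[OF W T]) blast
  have "E W (t *\<^sub>R w') \<le> c"
  proof (rule ccontr)
    assume "\<not> ?thesis"
    then have big: "E W (t *\<^sub>R w') > c" by simp
    define z where "z n = w n - w'" for n
    have L0: "0 \<le> L" using L[of 0] norm_ge_zero order_trans by blast
    have Z0: "L + norm w' > 0" using L0 w' by (simp add: add_nonneg_pos)
    have z: "norm (z n) \<le> L + norm w'" for n
      using norm_triangle_ineq4[of "w n" w'] L[of n] by (simp add: z_def)
    have scaled: "E (V n) (s *\<^sub>R w n) \<le> E (V n) (w n)" if "s \<ge> 0" for n s
      using w(1)[of n] that by (simp add: peak_def)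
    have D1: "(\<lambda>n. E (V n) (t *\<^sub>R w n) - E W (t *\<^sub>R w') - E (V n) (t *\<^sub>R z n)) \<longlonglongrightarrow> 0"
      unfolding z_def using t(1) by (intro energy_splitting[OF V L lim, of _ t]) auto
    have "(\<lambda>n. E (V n) (w n) - E W (t *\<^sub>R w')
        - (E (V n) (t *\<^sub>R w n) - E W (t *\<^sub>R w') - E (V n) (t *\<^sub>R z n))) \<longlonglongrightarrow> c - E W (t *\<^sub>R w') - 0"
      by (intro tendsto_diff w(2) D1 tendsto_const)
    then have "eventually (\<lambda>n. E (V n) (w n) - E W (t *\<^sub>R w')
        - (E (V n) (t *\<^sub>R w n) - E W (t *\<^sub>R w') - E (V n) (t *\<^sub>R z n)) < 0) sequentially"
      by (rule order_tendstoD(2)) (use big in simp)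
    then have neg: "eventually (\<lambda>n. E (V n) (t *\<^sub>R z n) < 0) sequentially"
    proof (rule eventually_mono)
      fix n assume "E (V n) (w n) - E W (t *\<^sub>R w')
        - (E (V n) (t *\<^sub>R w n) - E W (t *\<^sub>R w') - E (V n) (t *\<^sub>R z n)) < 0"
      then show "E (V n) (t *\<^sub>R z n) < 0" using scaled[of t n] t(1) by linarith
    qed
    \<comment> \<open>Any default scale in range will do at the finitely many indices where the energy is not negative.\<close>
    have "\<exists>s. 0 \<le> s \<and> s \<le> t \<and> (E (V n) (t *\<^sub>R z n) < 0 \<longrightarrow> 0 < s \<and> peak (V n) (s *\<^sub>R z n))" for n
    proof (cases "E (V n) (t *\<^sub>R z n) < 0")
      case True
      then obtain s where "0 < s" "s < t" "peak (V n) (s *\<^sub>R z n)"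
        using peak_exists[OF V(1) t(1)] by metis
      then show ?thesis by (intro exI[of _ s]) auto
    qed (use t(1) in auto)
    then obtain s where s: "\<And>n. 0 \<le> s n" "\<And>n. s n \<le> t"
      and s_peak: "\<And>n. E (V n) (t *\<^sub>R z n) < 0 \<Longrightarrow> 0 < s n \<and> peak (V n) (s n *\<^sub>R z n)"
      by metis
    have D2: "(\<lambda>n. E (V n) (s n *\<^sub>R w n) - E W (s n *\<^sub>R w') - E (V n) (s n *\<^sub>R z n)) \<longlonglongrightarrow> 0"
      unfolding z_def by (rule energy_splitting[OF V L lim s])
    \<comment> \<open>The lower bound for the scales \<open>s n\<close>, and the resulting lower bound for \<open>E W (s n w')\<close>.\<close>
    define d where "d = \<eta> / 2 / (L + norm w')"
    have d: "d > 0" using \<eta>(1) Z0 by (simp add: d_def)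
    define \<kappa> where "\<kappa> = (d / t)\<^sup>2 * E W (t *\<^sub>R w')"
    have \<kappa>: "\<kappa> > 0" unfolding \<kappa>_def using d t peak_energy_pos[OF W t(2)] by (intro mult_pos_pos) auto
    have "(\<lambda>n. E (V n) (w n) - c - (E (V n) (s n *\<^sub>R w n) - E W (s n *\<^sub>R w') - E (V n) (s n *\<^sub>R z n)))
        \<longlonglongrightarrow> c - c - 0"
      by (intro tendsto_diff w(2) D2 tendsto_const)
    then have "eventually (\<lambda>n. E (V n) (w n) - c
        - (E (V n) (s n *\<^sub>R w n) - E W (s n *\<^sub>R w') - E (V n) (s n *\<^sub>R z n)) < \<kappa>) sequentially"
      by (rule order_tendstoD(2)) (use \<kappa> in simp)
    from eventually_conj[OF this neg] obtain n where
      n: "E (V n) (w n) - c - (E (V n) (s n *\<^sub>R w n) - E W (s n *\<^sub>R w') - E (V n) (s n *\<^sub>R z n)) < \<kappa>"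
        "E (V n) (t *\<^sub>R z n) < 0"
      by (auto simp: eventually_sequentially)
    have sn: "0 < s n" "peak (V n) (s n *\<^sub>R z n)" using s_peak[OF n(2)] by auto
    obtain x where "\<bar>h1_fun (s n *\<^sub>R z n) x\<bar> > \<eta> / 2" by (rule peak_nonvanishing[OF V(1) sn(2)])
    also have "\<bar>h1_fun (s n *\<^sub>R z n) x\<bar> \<le> norm (s n *\<^sub>R z n)" by (rule h1_fun_le_norm)
    also have "\<dots> \<le> s n * (L + norm w')" using sn(1) z[of n] by simp
    finally have "\<eta> / 2 \<le> s n * (L + norm w')" by simp
    then have ds: "d \<le> s n" using Z0 by (simp only: d_def pos_divide_le_eq)
    have "E W (t *\<^sub>R w') \<le> (t / s n)\<^sup>2 * E W (s n *\<^sub>R w')"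
      by (rule energy_ray_compare[OF W sn(1) s(2)])
    then have "(s n / t)\<^sup>2 * E W (t *\<^sub>R w') \<le> (s n / t)\<^sup>2 * ((t / s n)\<^sup>2 * E W (s n *\<^sub>R w'))"
      by (intro mult_left_mono) auto
    also have "\<dots> = E W (s n *\<^sub>R w')" using sn(1) t(1) by (simp add: power_divide)
    finally have "(s n / t)\<^sup>2 * E W (t *\<^sub>R w') \<le> E W (s n *\<^sub>R w')" .
    moreover have "\<kappa> \<le> (s n / t)\<^sup>2 * E W (t *\<^sub>R w')"
      unfolding \<kappa>_def using ds d t peak_energy_pos[OF W t(2)]
      by (intro mult_right_mono power_mono divide_right_mono) auto
    moreover have "c \<le> E (V n) (s n *\<^sub>R z n)" by (rule c[OF sn(2)])
    moreover have "E (V n) (s n *\<^sub>R w n) \<le> E (V n) (w n)" by (rule scaled[OF s(1)])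
    ultimately show False using n(1) by linarith
  qed
  then show ?thesis using that t(2) by blast
qed

text \<open>Translate the peaks of a minimising sequence so that each is bounded away from 0 at the origin, and
  pass to a nonzero pointwise limit. If the translations repeat a value infinitely often, then the limit
  potential is a translate of \<open>V\<close>. Otherwise they tend to infinity, the limit potential is the
  constant \<open>Vinf\<close>, and \<open>V \<le> Vinf\<close> shows that the ray of the limit peak contains a peak for \<open>V\<close> that
  is no higher. In both cases the limit peak yields a peak for \<open>V\<close> of energy at most the infimum.\<close>

lemma minimal_peak_exists:
  fixes V :: "int ^ 'n::finite \<Rightarrow> real"
  assumes V: "potential V" and le: "\<And>x. V x \<le> Vinf"
    and tends: "(V \<longlongrightarrow> Vinf) (filtercomap lattice_norm at_top)"
  obtains u where "peak V u" "\<And>v. peak V v \<Longrightarrow> E V u \<le> E V v"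
proof -
  define A where "A = E V ` {u. peak V u}"
  define c where "c = Inf A"
  have c: "c \<le> E V v" if "peak V v" for v
    unfolding c_def using that peak_energy_pos[OF V]
    by (intro cInf_lower) (auto simp: A_def intro!: bdd_belowI[of _ 0] less_imp_le)
  have to_peak: "\<exists>t>0. peak P (t *\<^sub>R u)" if P: "potential P" and u: "u \<noteq> 0" for P and u :: "'n h1"
  proof -
    obtain T where "T > 0" "E P (T *\<^sub>R u) < 0" by (rule energy_ray_negative[OF P u])
    then show ?thesis using peak_exists[OF P] by metis
  qed
  have "\<exists>u :: 'n h1. u \<noteq> 0"
  proof -
    have "sqsum (\<lambda>x :: int ^ 'n. if x = 0 then 1 else 0 :: real)"
      unfolding sqsum_def by (rule finite_nonzero_values_imp_summable_on) auto
    from h1_fun_Abs[OF this] show ?thesis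
      by (metis h1_fun_simps(1) zero_neq_one)
  qed
  then have "A \<noteq> {}" using to_peak[OF V] by (auto simp: A_def)
  have "\<exists>u. peak V u \<and> E V u < c + inverse (real (Suc n))" for n
  proof -
    have "Inf A < c + inverse (real (Suc n))" by (simp add: c_def)
    from cInf_lessD[OF \<open>A \<noteq> {}\<close> this] show ?thesis by (auto simp: A_def)
  qed
  then obtain u where u: "\<And>n. peak V (u n)" "\<And>n. E V (u n) < c + inverse (real (Suc n))" by metis
  have u_lim: "(\<lambda>n. E V (u n)) \<longlonglongrightarrow> c"
  proof (rule tendsto_sandwich[OF _ _ tendsto_const])
    show "(\<lambda>n. c + inverse (real (Suc n))) \<longlonglongrightarrow> c" by (rule LIMSEQ_inverse_real_of_nat_add)
  qed (use u c in \<open>auto intro!: always_eventually less_imp_le\<close>)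
  have "E V (u n) \<le> c + 1" for n
    using u(2)[of n] inverse_le_1_iff[of "real (Suc n)"] by simp
  moreover obtain L where "\<And>P (v :: 'n h1). potential P \<Longrightarrow> peak P v \<Longrightarrow> E P v \<le> c + 1 \<Longrightarrow> norm v \<le> L"
    by (rule peaks_bounded[of "c + 1"]) blast
  ultimately have L: "norm (u n) \<le> L" for n using u(1) V by blast
  have "\<exists>x. \<bar>h1_fun (u n) x\<bar> > \<eta> / 2" for n using peak_nonvanishing[OF V u(1)] by metis
  then obtain k where k: "\<And>n. \<bar>h1_fun (u n) (k n)\<bar> > \<eta> / 2" by metis
  obtain r W where r: "strict_mono (r :: nat \<Rightarrow> nat)" and W: "\<And>x. (\<lambda>n. V (x + k (r n))) \<longlonglongrightarrow> W x"
    and to_V: "\<And>v. potential W \<Longrightarrow> peak W v \<Longrightarrow> \<exists>v'. peak V v' \<and> E V v' \<le> E W v"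
  proof (cases "\<exists>y. infinite {n. k n = y}")
    case True
    then obtain y where "infinite {n. k n = y}" by blast
    from infinite_enumerate[OF this] obtain r where "strict_mono (r :: nat \<Rightarrow> nat)"
      "\<forall>n. r n \<in> {n. k n = y}" by blast
    moreover from this have "k (r n) = y" for n by simp
    moreover have "\<exists>v'. peak V v' \<and> E V v' \<le> E (\<lambda>x. V (x + y)) v" if "peak (\<lambda>x. V (x + y)) v" for v
      using that peak_translate[of V y "translate_h1 (- y) v"] energy_translate[of V y "translate_h1 (- y) v"]
      by (intro exI[of _ "translate_h1 (- y) v"]) simp
    ultimately show ?thesis using that[of r "\<lambda>x. V (x + y)"] by simp
  next
    case False
    have "filterlim (\<lambda>n. x + k n) (filtercomap lattice_norm at_top) sequentially" for x
      using lattice_norm_tendsto[of k x] False by (simp add: filterlim_filtercomap_iff o_def)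
    then have "(\<lambda>n. V (x + k n)) \<longlonglongrightarrow> Vinf" for x by (rule filterlim_compose[OF tends])
    moreover have "\<exists>v'. peak V v' \<and> E V v' \<le> E (\<lambda>_. Vinf) v"
      if P: "potential (\<lambda>_ :: int ^ 'n. Vinf)" and v: "peak (\<lambda>_. Vinf) v" for v :: "'n h1"
    proof -
      obtain t where t: "t > 0" "peak V (t *\<^sub>R v)" using to_peak[OF V] v unfolding peak_def by blast
      have "E V (t *\<^sub>R v) \<le> E (\<lambda>_. Vinf) (t *\<^sub>R v)" by (rule energy_mono[OF V P le])
      also have "\<dots> \<le> E (\<lambda>_. Vinf) v" using v t(1) by (simp add: peak_def)
      finally show ?thesis using t(2) by blast
    qed
    ultimately show ?thesis using that[of id "\<lambda>_. Vinf"] by (simp add: strict_mono_id)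
  qed
  define w where "w n = translate_h1 (k (r n)) (u (r n))" for n
  have wL: "norm (w n) \<le> L" for n using L by (simp add: w_def)
  have "norm (h1_fun (w n) x) \<le> L" for n x
    using h1_fun_le_norm[of "w n" x] wL[of n] by simp
  then obtain r' where r': "strict_mono (r' :: nat \<Rightarrow> nat)"
    "\<And>x. x \<in> UNIV \<Longrightarrow> \<exists>l. (\<lambda>n. h1_fun (w (r' n)) x) \<longlonglongrightarrow> l"
    using function_convergent_subsequence[of UNIV "\<lambda>n. h1_fun (w n)" L] by (metis countableI_type)
  then obtain g where g: "\<And>x. (\<lambda>n. h1_fun (w (r' n)) x) \<longlonglongrightarrow> g x" by (metis UNIV_I)
  obtain w' where w': "h1_fun w' = g" using h1_pointwise_limit[OF wL g] by blast
  have "\<bar>g 0\<bar> \<ge> \<eta> / 2"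
  proof (rule LIMSEQ_le_const)
    show "(\<lambda>n. \<bar>h1_fun (w (r' n)) 0\<bar>) \<longlonglongrightarrow> \<bar>g 0\<bar>" by (intro tendsto_intros g)
    show "\<exists>N. \<forall>n\<ge>N. \<eta> / 2 \<le> \<bar>h1_fun (w (r' n)) 0\<bar>" using k by (auto simp: w_def less_imp_le)
  qed
  then have w'0: "w' \<noteq> 0" using w' \<eta>(1) by auto
  define P where "P n = (\<lambda>x. V (x + k (r (r' n))))" for n
  have Pw: "E (P n) (w (r' n)) = E V (u (r (r' n)))" "peak (P n) (w (r' n))" for n
    using u(1) by (simp_all add: P_def w_def energy_translate peak_translate)
  have PV: "potential (P n)" for n using potential_translate[OF V] by (simp add: P_def)
  have PW: "(\<lambda>n. P n x) \<longlonglongrightarrow> W x" for x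
    using LIMSEQ_subseq_LIMSEQ[OF W r'(1)] by (simp add: P_def o_def)
  have Pc: "c \<le> E (P n) v" if "peak (P n) v" for n v
    using c[of "translate_h1 (- k (r (r' n))) v"] that
      peak_translate[of V "k (r (r' n))" "translate_h1 (- k (r (r' n))) v"]
      energy_translate[of V "k (r (r' n))" "translate_h1 (- k (r (r' n))) v"]
    by (simp add: P_def)
  have Plim: "(\<lambda>n. E (P n) (w (r' n))) \<longlonglongrightarrow> c"
    unfolding Pw using LIMSEQ_subseq_LIMSEQ[OF LIMSEQ_subseq_LIMSEQ[OF u_lim r] r'(1)] by (simp add: o_def)
  obtain v where v: "peak W v" "E W v \<le> c"
    by (rule minimising_limit[OF PV PW Pc Pw(2) Plim wL g[folded w'] w'0]) auto
  obtain v' where "peak V v'" "E V v' \<le> E W v"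
    using to_V[OF potential_limit[OF PV PW] v(1)] by blast
  then show ?thesis using that[of v'] c v(2) by (meson order_trans)
qed

end

section \<open>Existence of a ground state\<close>

theorem theorem1p2:
  fixes f :: "real \<Rightarrow> real" and a q :: real and V :: "int ^ 'n::finite \<Rightarrow> real"
  assumes "continuous_on UNIV f"
    and "a > 0" and "q > 2"
    and "\<And>u. \<bar>f u\<bar> \<le> a * (\<bar>u\<bar> + \<bar>u\<bar> powr (q - 1))"
    and "f \<in> o[at 0](\<lambda>u. u)"
    and "strict_mono_on {..<0} (\<lambda>u. f u / \<bar>u\<bar>)"
    and "strict_mono_on {0<..} (\<lambda>u. f u / \<bar>u\<bar>)"
    and "filterlim (\<lambda>u. antideriv f u / u\<^sup>2) at_top at_infinity"
    and "bounded_potential_well V"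
  shows "\<exists>u :: 'n h1. ground_state_solution V f u"
proof -
  obtain V0 Vinf where bnd: "bounded (range V)" and V0: "0 < V0" "V0 \<le> (INF x. V x)"
    and Vinf: "(SUP x. V x) = Vinf" and tends: "(V \<longlongrightarrow> Vinf) (filtercomap lattice_norm at_top)"
    using assms(9) by (auto simp: bounded_potential_well_def)
  have V: "V0 \<le> V x" "V x \<le> Vinf" for x
    using V0(2) cINF_lower[OF bounded_imp_bdd_below[OF bnd], of x]
      cSUP_upper[OF UNIV_I bounded_imp_bdd_above[OF bnd], of x] Vinf by simp_all
  interpret lattice_energy f a q "min 1 V0" "max 1 Vinf"
    by unfold_locales (use assms V0(1) in auto)
  have pot: "potential V"
    unfolding potential_def using V by (auto simp: min_le_iff_disj le_max_iff_disj)
  obtain u where u: "peak V u" "\<And>v. peak V v \<Longrightarrow> E V u \<le> E V v"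
    by (rule minimal_peak_exists[OF pot V(2) tends]) blast
  have crit: "critical_point (E V) u" by (rule minimal_peak_critical[OF pot u])
  have "ground_state_solution V f u"
    unfolding ground_state_solution_def
    using critical_point_solves[OF pot crit] crit peak_energy_pos[OF pot u(1)]
      u(2) critical_positive_imp_peak[OF pot] by blast
  then show ?thesis by blast
qed

end
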